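(* Every solution of the discrete scheme given in the context satisfies $$0\le S_{h,\tau}\le1 .$$
   Context: Data. $d\in\{2,3\}$, $\Omega\subset\mathbb R^d$ is a bounded connected Lipschitz polygon ($d=2$) or polyhedron ($d=3$), $T>0$. The porosity $\varphi$ is piecewise constant in space, independent of time, positive, bounded, and bounded away from zero. The mobilities $\eta_w,\eta_o:[0,1]\to[0,\infty)$ are continuous, $\eta_w$ is increasing, $\eta_o$ is decreasing, and $\eta_w+\eta_o\ge\eta_\ast$ on $[0,1]$ for a constant $\eta_\ast>0$. Set $f_w=\eta_w/(\eta_w+\eta_o)$, $f_o=1-f_w$. The capillary pressure $p_c\in W^{1,1}(0,1)$ is continuous and strictly decreasing. $\bar q,\underline q\in L^2(\Omega\times]0,T[)$, $\bar q\ge0$, $\underline q\ge0$, $\int_\Omega\bar q=\int_\Omega\underline q$ (at a.e. time). $0\le s_{\mathrm{in}}\le1$ a.e. in $\Omega\times]0,T[$ and $0\le s_w^0\le1$ a.e. in $\Omega$. The functions $p_c,\eta_\alpha,f_\alpha$ ($\alpha=w,o$) are extended continuously by constants to $\mathbb R$. Mesh. $\mathcal T_h$ is a regular (shape-regular) family of conforming simplicial meshes of $\Omega$ with mesh size $h$, in which each angle is not larger than $\pi/2$, so that $\int_K\nabla\phi_i\cdot\nabla\phi_j\le0$ for all $K$ and $i\ne j$; $\varphi$ is constant on each element. $X_h$ is the space of continuous functions on $\overline\Omega$ that are affine on each $K\in\mathcal T_h$, with nodes $\mathbf x_1,\dots,\mathbf x_M$ and nodal (hat) basis $\phi_1,\dots,\phi_M$.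 $\Delta_i$ is the union of the elements sharing node $i$; $c_{ij}=\int_{\Delta_i\cap\Delta_j}|\nabla\phi_i\cdot\nabla\phi_j|$; $m_i=\frac{|\Delta_i|}{d+1}$; $\tilde m_i(\varphi)=\frac1{d+1}\sum_{K\subset\Delta_i}\varphi|_K|K|$. Scheme. $\tau=T/N$, $t_n=n\tau$. $\rho_\tau(f)$ is the function equal to $\frac1\tau\int_{t_{n-1}}^{t_n}f$ on $]t_{n-1},t_n]$; $r_h(f)\in X_h$ has nodal values $\frac1{|\Delta_i|}\int_{\Delta_i}f$. $S_h^0=r_h(s_w^0)$, $s_{\mathrm{in},h,\tau}=\rho_\tau(r_h(s_{\mathrm{in}}))$, $\bar q_{h,\tau}=\rho_\tau\big(r_h(\bar q)-\frac1{|\Omega|}\int_\Omega(r_h(\bar q)-\bar q)\big)$ and similarly $\underline q_{h,\tau}$; their values at node $i$ on $]t_{n-1},t_n]$ are denoted $s_{\mathrm{in}}^{n,i},\bar q^{n,i},\underline q^{n,i}$. A discrete solution consists of $S_h^n=\sum_iS^{n,i}\phi_i$, $P_{\alpha,h}^n=\sum_iP_\alpha^{n,i}\phi_i$ ($\alpha=w,o$), $1\le n\le N$, such that for all $1\le i\le M$ $$\tfrac{\tilde m_i(\varphi)}\tau(S^{n,i}-S^{n-1,i})-\sum_{j=1}^Mc_{ij}\eta_w(S_w^{n,ij})(P_w^{n,j}-P_w^{n,i})=m_i\big(f_w(s_{\mathrm{in}}^{n,i})\bar q^{n,i}-f_w(S^{n,i})\underline q^{n,i}\big),$$ $$-\tfrac{\tilde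 m_i(\varphi)}\tau(S^{n,i}-S^{n-1,i})-\sum_{j=1}^Mc_{ij}\eta_o(S_o^{n,ij})(P_o^{n,j}-P_o^{n,i})=m_i\big(f_o(s_{\mathrm{in}}^{n,i})\bar q^{n,i}-f_o(S^{n,i})\underline q^{n,i}\big),$$ $P_o^{n,i}-P_w^{n,i}=p_c(S^{n,i})$, and $\sum_im_iP_w^{n,i}=0$. Upwinding: $S_\alpha^{n,ij}=S^{n,i}$ if $P_\alpha^{n,i}>P_\alpha^{n,j}$, $S_\alpha^{n,ij}=S^{n,j}$ if $P_\alpha^{n,i}<P_\alpha^{n,j}$; if $P_\alpha^{n,i}=P_\alpha^{n,j}$, then $S_w^{n,ij}=\max(S^{n,i},S^{n,j})$ and $S_o^{n,ij}=\min(S^{n,i},S^{n,j})$. $S_{h,\tau}$ is the function equal to $S_h^n$ for $t\in]t_{n-1},t_n]$ (and $S_h^0$ at $t=0$). *)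

theory Defs
  imports "HOL-Analysis.Analysis"
begin

definition in_L2 :: "'a::euclidean_space set \<Rightarrow> ('a \<Rightarrow> real) \<Rightarrow> bool" where
  "in_L2 S f \<longleftrightarrow> f \<in> borel_measurable (lebesgue_on S) \<and>
     integrable (lebesgue_on S) (\<lambda>x. (f x)\<^sup>2)"

definition test_function :: "real \<Rightarrow> real \<Rightarrow> (real \<Rightarrow> real) \<Rightarrow> bool" where
  "test_function a b \<psi> \<longleftrightarrow>
     (\<forall>k y. (deriv ^^ k) \<psi> differentiable (at y)) \<and>
     (\<exists>c d. a < c \<and> c \<le> d \<and> d < b \<and> (\<forall>y. y \<notin> {c..d} \<longrightarrow> \<psi> y = 0))"

definition in_W11 :: "real \<Rightarrow> real \<Rightarrow> (real \<Rightarrow> real) \<Rightarrow> bool" where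
  "in_W11 a b f \<longleftrightarrow> integrable (lebesgue_on {a<..<b}) f \<and>
     (\<exists>g. integrable (lebesgue_on {a<..<b}) g \<and>
        (\<forall>\<psi>. test_function a b \<psi> \<longrightarrow>
           (LINT y|lebesgue_on {a<..<b}. f y * deriv \<psi> y) =
           - (LINT y|lebesgue_on {a<..<b}. g y * \<psi> y)))"

text \<open>Near each boundary point, in suitable orthogonal coordinates with vertical axis \<open>e\<close>,
  the domain is the set of points lying strictly below the graph of a Lipschitz function
  \<open>g\<close> of the horizontal component.\<close>

definition lipschitz_domain :: "'a::euclidean_space set \<Rightarrow> bool" where
  "lipschitz_domain \<Omega> \<longleftrightarrow> open \<Omega> \<and>
     (\<forall>p\<in>frontier \<Omega>. \<exists>e r L g. norm e = 1 \<and> 0 < r \<and> L-lipschitz_on {y. y \<bullet> e = 0} g \<and>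
        (\<forall>y\<in>ball p r. y \<in> \<Omega> \<longleftrightarrow> y \<bullet> e < g (y - (y \<bullet> e) *\<^sub>R e)))"

definition polytopal :: "'a::euclidean_space set \<Rightarrow> bool" where
  "polytopal \<Omega> \<longleftrightarrow> (\<exists>F. finite F \<and> (\<forall>P\<in>F. polytope P) \<and> closure \<Omega> = \<Union>F)"

abbreviation vertices :: "'a::euclidean_space set \<Rightarrow> 'a set" where
  "vertices K \<equiv> {v. v extreme_point_of K}"

text \<open>The angle between the two facets of the simplex with vertex set \<open>C\<close> that meet along the
  face spanned by \<open>C - {a, b}\<close>.  In dimension 2 that face is the third vertex, and this is the
  usual angle of the triangle at it; in dimension 3 it is the dihedral angle at an edge.\<close>

definition simplex_angle :: "'a::euclidean_space set \<Rightarrow> 'a \<Rightarrow> 'a \<Rightarrow> real" where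
  "simplex_angle C a b =
     (let R = affine hull (C - {a, b});
          u = a - closest_point R a;
          v = b - closest_point R b
      in arccos ((u \<bullet> v) / (norm u * norm v)))"

definition nonobtuse :: "'a::euclidean_space set \<Rightarrow> bool" where
  "nonobtuse K \<longleftrightarrow>
     (\<forall>a\<in>vertices K. \<forall>b\<in>vertices K. a \<noteq> b \<longrightarrow> simplex_angle (vertices K) a b \<le> pi / 2)"

definition conforming_simplicial_mesh :: "'a::euclidean_space set \<Rightarrow> 'a set set \<Rightarrow> bool" where
  "conforming_simplicial_mesh \<Omega> \<T> \<longleftrightarrow>
     triangulation \<T> \<and> (\<forall>K\<in>\<T>. int DIM('a) simplex K) \<and> \<Union>\<T> = closure \<Omega>"

definition inball_diameter :: "'a::euclidean_space set \<Rightarrow> real" where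
  "inball_diameter K = Sup {2 * r | r. 0 \<le> r \<and> (\<exists>c. cball c r \<subseteq> K)}"

text \<open>The family is indexed by its mesh sizes \<open>h\<close>; the bound \<open>\<sigma>\<close> is uniform over the family.\<close>

definition regular_mesh_family ::
    "'a::euclidean_space set \<Rightarrow> real set \<Rightarrow> (real \<Rightarrow> 'a set set) \<Rightarrow> bool" where
  "regular_mesh_family \<Omega> H Th \<longleftrightarrow>
     (\<forall>h\<in>H. conforming_simplicial_mesh \<Omega> (Th h) \<and> h = Max (diameter ` Th h)) \<and>
     (\<exists>\<sigma>. \<forall>h\<in>H. \<forall>K\<in>Th h. diameter K \<le> \<sigma> * inball_diameter K)"

definition mesh_nodes :: "'a::euclidean_space set set \<Rightarrow> 'a set" where
  "mesh_nodes \<T> = (\<Union>K\<in>\<T>. vertices K)"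

definition P1_space :: "'a::euclidean_space set \<Rightarrow> 'a set set \<Rightarrow> ('a \<Rightarrow> real) set" where
  "P1_space \<Omega> \<T> =
     {v. continuous_on (closure \<Omega>) v \<and> (\<forall>K\<in>\<T>. \<exists>a c. \<forall>y\<in>K. v y = a \<bullet> y + c)}"

definition nodal_basis ::
    "'a::euclidean_space set \<Rightarrow> 'a set set \<Rightarrow> nat \<Rightarrow> (nat \<Rightarrow> 'a) \<Rightarrow> (nat \<Rightarrow> 'a \<Rightarrow> real) \<Rightarrow> bool" where
  "nodal_basis \<Omega> \<T> M x \<phi> \<longleftrightarrow>
     bij_betw x {1..M} (mesh_nodes \<T>) \<and>
     (\<forall>i\<in>{1..M}. \<phi> i \<in> P1_space \<Omega> \<T> \<and>
        (\<forall>j\<in>{1..M}. \<phi> i (x j) = (if i = j then 1 else 0)))"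

definition patch :: "'a::euclidean_space set set \<Rightarrow> 'a \<Rightarrow> 'a set" where
  "patch \<T> p = \<Union>{K\<in>\<T>. p \<in> vertices K}"

definition lumped_mass :: "'a::euclidean_space set set \<Rightarrow> 'a \<Rightarrow> real" where
  "lumped_mass \<T> p = measure lebesgue (patch \<T> p) / (real DIM('a) + 1)"

text \<open>Coefficients are understood up to null sets, so the value of a piecewise constant
  function on an element is its almost everywhere value there.\<close>

definition element_value :: "('a::euclidean_space \<Rightarrow> real) \<Rightarrow> 'a set \<Rightarrow> real" where
  "element_value f K = (THE c. AE y in lebesgue_on K. f y = c)"

definition weighted_mass ::
    "('a::euclidean_space \<Rightarrow> real) \<Rightarrow> 'a set set \<Rightarrow> 'a \<Rightarrow> real" where
  "weighted_mass f \<T> p =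
     (\<Sum>K\<in>{K\<in>\<T>. p \<in> vertices K}. element_value f K * measure lebesgue K) / (real DIM('a) + 1)"

text \<open>Only meaningful where \<open>f\<close> is differentiable; for the basis functions this holds in the
  interior of each element, that is, outside a null set.\<close>

definition gradient :: "('a::euclidean_space \<Rightarrow> real) \<Rightarrow> 'a \<Rightarrow> 'a" where
  "gradient f y = (THE D. GDERIV f y :> D)"

definition edge_coeff ::
    "'a::euclidean_space set set \<Rightarrow> (nat \<Rightarrow> 'a) \<Rightarrow> (nat \<Rightarrow> 'a \<Rightarrow> real) \<Rightarrow> nat \<Rightarrow> nat \<Rightarrow> real" where
  "edge_coeff \<T> x \<phi> i j =
     (LINT y|lebesgue_on (patch \<T> (x i) \<inter> patch \<T> (x j)). \<bar>gradient (\<phi> i) y \<bullet> gradient (\<phi> j) y\<bar>)"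

definition fe_fun :: "nat \<Rightarrow> (nat \<Rightarrow> 'a \<Rightarrow> real) \<Rightarrow> (nat \<Rightarrow> real) \<Rightarrow> 'a \<Rightarrow> real" where
  "fe_fun M \<phi> c y = (\<Sum>i=1..M. c i * \<phi> i y)"

definition r_h :: "'a::euclidean_space set set \<Rightarrow> nat \<Rightarrow> (nat \<Rightarrow> 'a) \<Rightarrow> (nat \<Rightarrow> 'a \<Rightarrow> real) \<Rightarrow>
    ('a \<Rightarrow> real) \<Rightarrow> 'a \<Rightarrow> real" where
  "r_h \<T> M x \<phi> f =
     fe_fun M \<phi> (\<lambda>i. (LINT y|lebesgue_on (patch \<T> (x i)). f y) / measure lebesgue (patch \<T> (x i)))"

text \<open>The \<open>n\<close> with \<open>t \<in> ](n - 1) \<tau>, n \<tau>]\<close> if \<open>t > 0\<close>, and \<open>0\<close> if \<open>t = 0\<close>.\<close>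

definition step_index :: "real \<Rightarrow> real \<Rightarrow> nat" where
  "step_index \<tau> t = nat \<lceil>t / \<tau>\<rceil>"

definition \<rho> :: "real \<Rightarrow> (real \<Rightarrow> real) \<Rightarrow> real \<Rightarrow> real" where
  "\<rho> \<tau> f t =
     (LINT s|lebesgue_on {(real (step_index \<tau> t) - 1) * \<tau> .. real (step_index \<tau> t) * \<tau>}. f s) / \<tau>"

text \<open>Space-time functions take a pair of a point and a time; their discretizations are
  written with the time as the first, curried argument.\<close>

definition saturation_h\<tau> :: "'a::euclidean_space set set \<Rightarrow> nat \<Rightarrow> (nat \<Rightarrow> 'a) \<Rightarrow>
    (nat \<Rightarrow> 'a \<Rightarrow> real) \<Rightarrow> real \<Rightarrow> ('a \<times> real \<Rightarrow> real) \<Rightarrow> real \<Rightarrow> 'a \<Rightarrow> real" where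
  "saturation_h\<tau> \<T> M x \<phi> \<tau> s t y = \<rho> \<tau> (\<lambda>t'. r_h \<T> M x \<phi> (\<lambda>z. s (z, t')) y) t"

definition flow_rate_h\<tau> :: "'a::euclidean_space set \<Rightarrow> 'a set set \<Rightarrow> nat \<Rightarrow> (nat \<Rightarrow> 'a) \<Rightarrow>
    (nat \<Rightarrow> 'a \<Rightarrow> real) \<Rightarrow> real \<Rightarrow> ('a \<times> real \<Rightarrow> real) \<Rightarrow> real \<Rightarrow> 'a \<Rightarrow> real" where
  "flow_rate_h\<tau> \<Omega> \<T> M x \<phi> \<tau> q t y =
     \<rho> \<tau> (\<lambda>t'. r_h \<T> M x \<phi> (\<lambda>z. q (z, t')) y
        - (LINT z|lebesgue_on \<Omega>. r_h \<T> M x \<phi> (\<lambda>z. q (z, t')) z - q (z, t')) / measure lebesgue \<Omega>) t"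

text \<open>Continuous extension by constants of a function given on \<open>[0, 1]\<close>.\<close>

abbreviation ext01 :: "(real \<Rightarrow> real) \<Rightarrow> real \<Rightarrow> real" where
  "ext01 f \<equiv> ext_cont f 0 1"

definition frac_w :: "(real \<Rightarrow> real) \<Rightarrow> (real \<Rightarrow> real) \<Rightarrow> real \<Rightarrow> real" where
  "frac_w \<eta>\<^sub>w \<eta>\<^sub>o s = \<eta>\<^sub>w s / (\<eta>\<^sub>w s + \<eta>\<^sub>o s)"

definition frac_o :: "(real \<Rightarrow> real) \<Rightarrow> (real \<Rightarrow> real) \<Rightarrow> real \<Rightarrow> real" where
  "frac_o \<eta>\<^sub>w \<eta>\<^sub>o s = 1 - frac_w \<eta>\<^sub>w \<eta>\<^sub>o s"

definition upwind_w :: "(nat \<Rightarrow> real) \<Rightarrow> (nat \<Rightarrow> real) \<Rightarrow> nat \<Rightarrow> nat \<Rightarrow> real" where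
  "upwind_w P S i j =
     (if P i > P j then S i else if P i < P j then S j else max (S i) (S j))"

definition upwind_o :: "(nat \<Rightarrow> real) \<Rightarrow> (nat \<Rightarrow> real) \<Rightarrow> nat \<Rightarrow> nat \<Rightarrow> real" where
  "upwind_o P S i j =
     (if P i > P j then S i else if P i < P j then S j else min (S i) (S j))"

text \<open>\<open>S n i\<close>, \<open>P\<^sub>w n i\<close> and \<open>P\<^sub>o n i\<close> are the nodal values at time step \<open>n\<close> and node \<open>x i\<close>; the
  pressures at step \<open>0\<close> play no role.  \<open>\<eta>\<^sub>w\<close>, \<open>\<eta>\<^sub>o\<close> and \<open>p\<^sub>c\<close> are only looked at on \<open>[0, 1]\<close>.\<close>

definition discrete_solution ::
    "'a::euclidean_space set \<Rightarrow> ('a \<Rightarrow> real) \<Rightarrow> (real \<Rightarrow> real) \<Rightarrow> (real \<Rightarrow> real) \<Rightarrow> (real \<Rightarrow> real) \<Rightarrow>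
     ('a \<times> real \<Rightarrow> real) \<Rightarrow> ('a \<times> real \<Rightarrow> real) \<Rightarrow> ('a \<times> real \<Rightarrow> real) \<Rightarrow> ('a \<Rightarrow> real) \<Rightarrow>
     'a set set \<Rightarrow> nat \<Rightarrow> (nat \<Rightarrow> 'a) \<Rightarrow> (nat \<Rightarrow> 'a \<Rightarrow> real) \<Rightarrow> real \<Rightarrow> nat \<Rightarrow>
     (nat \<Rightarrow> nat \<Rightarrow> real) \<Rightarrow> (nat \<Rightarrow> nat \<Rightarrow> real) \<Rightarrow> (nat \<Rightarrow> nat \<Rightarrow> real) \<Rightarrow> bool" where
  "discrete_solution \<Omega> por \<eta>\<^sub>w \<eta>\<^sub>o p\<^sub>c qin qout s\<^sub>i\<^sub>n s\<^sub>0 \<T> M x \<phi> \<tau> N S P\<^sub>w P\<^sub>o \<longleftrightarrow>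
     (\<forall>i\<in>{1..M}. S 0 i = r_h \<T> M x \<phi> s\<^sub>0 (x i)) \<and>
     (\<forall>n\<in>{1..N}.
       (\<forall>i\<in>{1..M}.
         (let m = lumped_mass \<T> (x i);
              dS = weighted_mass por \<T> (x i) / \<tau> * (S n i - S (n - 1) i);
              c = edge_coeff \<T> x \<phi> i;
              t\<^sub>n = real n * \<tau>;
              si = saturation_h\<tau> \<T> M x \<phi> \<tau> s\<^sub>i\<^sub>n t\<^sub>n (x i);
              qi = flow_rate_h\<tau> \<Omega> \<T> M x \<phi> \<tau> qin t\<^sub>n (x i);
              qo = flow_rate_h\<tau> \<Omega> \<T> M x \<phi> \<tau> qout t\<^sub>n (x i);
              f\<^sub>w = ext01 (frac_w \<eta>\<^sub>w \<eta>\<^sub>o);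
              f\<^sub>o = ext01 (frac_o \<eta>\<^sub>w \<eta>\<^sub>o)
          in dS - (\<Sum>j=1..M. c j * ext01 \<eta>\<^sub>w (upwind_w (P\<^sub>w n) (S n) i j) * (P\<^sub>w n j - P\<^sub>w n i))
                = m * (f\<^sub>w si * qi - f\<^sub>w (S n i) * qo) \<and>
             - dS - (\<Sum>j=1..M. c j * ext01 \<eta>\<^sub>o (upwind_o (P\<^sub>o n) (S n) i j) * (P\<^sub>o n j - P\<^sub>o n i))
                = m * (f\<^sub>o si * qi - f\<^sub>o (S n i) * qo) \<and>
             P\<^sub>o n i - P\<^sub>w n i = ext01 p\<^sub>c (S n i))) \<and>
       (\<Sum>i=1..M. lumped_mass \<T> (x i) * P\<^sub>w n i) = 0)"

definition S_h\<tau> :: "nat \<Rightarrow> (nat \<Rightarrow> 'a \<Rightarrow> real) \<Rightarrow> real \<Rightarrow> (nat \<Rightarrow> nat \<Rightarrow> real) \<Rightarrow> real \<Rightarrow> 'a \<Rightarrow> real" where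
  "S_h\<tau> M \<phi> \<tau> S t = fe_fun M \<phi> (S (step_index \<tau> t))"

end

theory Submission
  imports Defs
begin

text \<open>At a node where the saturation is minimal and negative, upwinding and the monotonicity of
  the mobilities and of the capillary pressure bound every numerical flux by the flux with the
  mobilities \<open>W\<close>, \<open>Z\<close> of that node.  Subtracting \<open>W\<close> times the oil balance from \<open>Z\<close> times the
  water balance cancels the outflow, and what remains forces the saturation not to decrease in the
  step; the upper bound is the same argument with the phases exchanged.  The inflow must be
  nonnegative: the averages of \<open>qin\<close> over patches are, and the correcting constant in the discrete
  rate vanishes, because a basis function has integral \<open>|K| / (d + 1)\<close> over each element \<open>K\<close> at
  its node, so that \<open>r\<^sub>h\<close> preserves integrals over \<open>\<Omega>\<close>.\<close>

subsection \<open>Monotonicity of one time step\<close>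

lemma clamp_01_eq: "clamp 0 1 s = max 0 (min 1 s)" for s :: real
  unfolding clamp_def Basis_real_def by simp

lemma ext01_eq: "ext01 f s = f (max 0 (min 1 s))"
  by (simp add: ext_cont_def clamp_01_eq)

lemma ext01_mono: "mono_on {0..1} f \<Longrightarrow> s \<le> t \<Longrightarrow> ext01 f s \<le> ext01 f t"
  unfolding ext01_eq by (rule mono_onD) auto

lemma ext01_antimono: "antimono_on {0..1} f \<Longrightarrow> s \<le> t \<Longrightarrow> ext01 f t \<le> ext01 f s"
  by (auto simp: ext01_eq monotone_on_def)

text \<open>The phases are kept abstract so that the inequality serves twice: with water and oil at
  a minimum, and with the phases exchanged at a maximum. \<open>W\<close> and \<open>Z\<close> are
  the mobilities at the node, \<open>a j\<close> and \<open>b j\<close> the pressure differences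
  towards node \<open>j\<close>, \<open>fw j\<close> and \<open>fo j\<close> the upwinded fluxes,
  and \<open>F\<close> the share of the first phase in the injected fluid. The extracted fluid is
  split in the ratio \<open>W\<close> to \<open>Z\<close>, so the crossed weights eliminate
  \<open>qo\<close>.\<close>

lemma phase_balance_nonneg:
  fixes a b fw fo c :: "nat \<Rightarrow> real" and W Z F D q qo m :: real
  assumes c: "\<And>j. j \<in> J \<Longrightarrow> 0 \<le> c j" and "0 \<le> m" "0 \<le> q" and WZ: "0 \<le> W" "0 \<le> Z" "0 < W + Z"
    and F: "W / (W + Z) \<le> F"
    and flux: "\<And>j. j \<in> J \<Longrightarrow> W * a j \<le> fw j" "\<And>j. j \<in> J \<Longrightarrow> fo j \<le> Z * b j" "\<And>j. j \<in> J \<Longrightarrow> b j \<le> a j"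
    and water: "D - (\<Sum>j\<in>J. c j * fw j) = m * (F * q - W / (W + Z) * qo)"
    and oil: "- D - (\<Sum>j\<in>J. c j * fo j) = m * ((1 - F) * q - (1 - W / (W + Z)) * qo)"
  shows "0 \<le> D"
proof -
  define X where "X = W / (W + Z)"
  have X: "X * (W + Z) = W"
    using WZ by (simp add: X_def)
  have D1: "D = (\<Sum>j\<in>J. c j * fw j) + m * (F * q - X * qo)"
    and D2: "- D = (\<Sum>j\<in>J. c j * fo j) + m * ((1 - F) * q - (1 - X) * qo)"
    using water oil by (simp_all add: X_def)
  have "(W + Z) * D = Z * D - W * (- D)"
    by (simp add: algebra_simps)
  also have "\<dots> = Z * ((\<Sum>j\<in>J. c j * fw j) + m * (F * q - X * qo))
      - W * ((\<Sum>j\<in>J. c j * fo j) + m * ((1 - F) * q - (1 - X) * qo))"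
    by (subst D1, subst D2) (rule refl)
  also have "\<dots> = (\<Sum>j\<in>J. c j * (Z * fw j - W * fo j)) + m * q * (F * (W + Z) - W) - m * qo * (X * (W + Z) - W)"
    by (simp add: algebra_simps sum_subtractf sum_distrib_left)
  also have "\<dots> = (\<Sum>j\<in>J. c j * (Z * fw j - W * fo j)) + m * q * (F * (W + Z) - W)"
    by (simp add: X)
  also have "\<dots> \<ge> 0"
  proof (intro add_nonneg_nonneg sum_nonneg mult_nonneg_nonneg)
    fix j assume j: "j \<in> J"
    \<comment> \<open>Both upwinded fluxes are compared with the fluxes at the node's own
      mobilities, where the order of the pressure differences decides.\<close>
    have "W * fo j \<le> W * (Z * b j)" "W * (Z * b j) \<le> W * (Z * a j)" "Z * (W * a j) \<le> Z * fw j"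
      using flux[OF j] WZ by (auto intro!: mult_left_mono)
    then show "0 \<le> Z * fw j - W * fo j"
      by (simp add: algebra_simps)
  next
    show "0 \<le> F * (W + Z) - W"
      using F WZ by (simp add: pos_divide_le_eq)
  qed (use c assms in auto)
  finally show ?thesis
    using WZ by (simp add: zero_le_mult_iff)
qed

text \<open>The mesh enters only through the signs of its coefficients, so the scheme is reduced to
  real arrays. It suffices to control the nodes of extremal saturation: were such a value out of
  range, the balance would place it on the admissible side of the value at the previous step, which
  is in range.\<close>

lemma saturation_step_bounds:
  fixes S S' P\<^sub>w P\<^sub>o w m q qo si :: "nat \<Rightarrow> real" and c :: "nat \<Rightarrow> nat \<Rightarrow> real"
  assumes mobility_w: "\<forall>s\<in>{0..1}. 0 \<le> \<eta>\<^sub>w s" "mono_on {0..1} \<eta>\<^sub>w"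
    and mobility_o: "\<forall>s\<in>{0..1}. 0 \<le> \<eta>\<^sub>o s" "antimono_on {0..1} \<eta>\<^sub>o"
    and mobility_sum: "\<forall>s\<in>{0..1}. 0 < \<eta>\<^sub>w s + \<eta>\<^sub>o s"
    and capillary: "antimono_on {0..1} p\<^sub>c"
    and w: "\<And>i. i \<in> {1..M} \<Longrightarrow> 0 < w i" and m: "\<And>i. i \<in> {1..M} \<Longrightarrow> 0 \<le> m i"
    and c: "\<And>i j. i \<in> {1..M} \<Longrightarrow> j \<in> {1..M} \<Longrightarrow> 0 \<le> c i j"
    and q: "\<And>i. i \<in> {1..M} \<Longrightarrow> 0 \<le> q i"
    and water: "\<And>i. i \<in> {1..M} \<Longrightarrow> w i * (S i - S' i)
         - (\<Sum>j=1..M. c i j * ext01 \<eta>\<^sub>w (upwind_w P\<^sub>w S i j) * (P\<^sub>w j - P\<^sub>w i))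
       = m i * (ext01 (frac_w \<eta>\<^sub>w \<eta>\<^sub>o) (si i) * q i - ext01 (frac_w \<eta>\<^sub>w \<eta>\<^sub>o) (S i) * qo i)"
    and oil: "\<And>i. i \<in> {1..M} \<Longrightarrow> - (w i * (S i - S' i))
         - (\<Sum>j=1..M. c i j * ext01 \<eta>\<^sub>o (upwind_o P\<^sub>o S i j) * (P\<^sub>o j - P\<^sub>o i))
       = m i * (ext01 (frac_o \<eta>\<^sub>w \<eta>\<^sub>o) (si i) * q i - ext01 (frac_o \<eta>\<^sub>w \<eta>\<^sub>o) (S i) * qo i)"
    and pressure: "\<And>i. i \<in> {1..M} \<Longrightarrow> P\<^sub>o i - P\<^sub>w i = ext01 p\<^sub>c (S i)"
    and S': "\<And>i. i \<in> {1..M} \<Longrightarrow> S' i \<in> {0..1}"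
    and k: "k \<in> {1..M}"
  shows "S k \<in> {0..1}"
proof -
  let ?W = "ext01 \<eta>\<^sub>w" and ?Z = "ext01 \<eta>\<^sub>o"
  have W: "0 \<le> ?W s" and Z: "0 \<le> ?Z s" and WZ: "0 < ?W s + ?Z s" for s
    using mobility_w mobility_o mobility_sum by (auto simp: ext01_eq)
  have fw: "ext01 (frac_w \<eta>\<^sub>w \<eta>\<^sub>o) s = ?W s / (?W s + ?Z s)" for s
    by (simp add: ext01_eq frac_w_def)
  have fo: "ext01 (frac_o \<eta>\<^sub>w \<eta>\<^sub>o) s = 1 - ext01 (frac_w \<eta>\<^sub>w \<eta>\<^sub>o) s" for s
    by (simp add: ext01_eq frac_o_def)
  \<comment> \<open>The fractional flow of oil in the shape required once the phases are
    exchanged.\<close>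
  have fo': "1 - ?W s / (?W s + ?Z s) = ?Z s / (?Z s + ?W s)" for s
    using WZ[of s] by (simp add: field_simps)
  have fw_mono: "?W s / (?W s + ?Z s) \<le> ?W t / (?W t + ?Z t)" if "?W s \<le> ?W t" "?Z t \<le> ?Z s" for s t
  proof -
    have "?W s * ?Z t \<le> ?W t * ?Z s"
      using that W Z by (intro mult_mono) auto
    then show ?thesis
      using WZ[of s] WZ[of t] by (simp add: field_simps)
  qed
  have water': "w i * (S i - S' i) - (\<Sum>j=1..M. c i j * (?W (upwind_w P\<^sub>w S i j) * (P\<^sub>w j - P\<^sub>w i)))
       = m i * (?W (si i) / (?W (si i) + ?Z (si i)) * q i - ?W (S i) / (?W (S i) + ?Z (S i)) * qo i)"
    and oil': "- (w i * (S i - S' i)) - (\<Sum>j=1..M. c i j * (?Z (upwind_o P\<^sub>o S i j) * (P\<^sub>o j - P\<^sub>o i)))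
       = m i * ((1 - ?W (si i) / (?W (si i) + ?Z (si i))) * q i - (1 - ?W (S i) / (?W (S i) + ?Z (S i))) * qo i)"
    if "i \<in> {1..M}" for i
    using water[OF that] oil[OF that] by (simp_all add: fw fo mult.assoc)
  have fin: "finite (S ` {1..M})" "S ` {1..M} \<noteq> {}"
    using k by auto
  have lower: "0 \<le> S k"
  proof -
    obtain i where i: "i \<in> {1..M}" "S i = Min (S ` {1..M})"
      using Min_in[OF fin] by force
    have le: "S i \<le> S j" if "j \<in> {1..M}" for j
      using that by (simp add: i(2))
    have "0 \<le> S i"
    proof (rule ccontr)
      assume neg: "\<not> 0 \<le> S i"
      have "0 \<le> w i * (S i - S' i)"
      proof (rule phase_balance_nonneg[OF c m q W Z WZ _ _ _ _ water' oil'])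
        \<comment> \<open>A negative saturation is clamped to 0, where the water mobility is
          smallest and the oil mobility largest, so no injected fluid can have a smaller water
          fraction.\<close>
        show "?W (S i) / (?W (S i) + ?Z (S i)) \<le> ?W (si i) / (?W (si i) + ?Z (si i))"
          using neg mobility_w(2) mobility_o(2) by (intro fw_mono) (auto simp: ext01_eq monotone_on_def)
      next
        fix j assume j: "j \<in> {1..M}"
        note mono = ext01_mono[OF mobility_w(2) le[OF j]] ext01_antimono[OF mobility_o(2) le[OF j]]
          ext01_antimono[OF capillary le[OF j]]
        \<comment> \<open>If water flows in from \<open>j\<close>, the upwind saturation is
          \<open>S j\<close>, at least the minimum, and the mobility can only grow; if it flows out,
          it is \<open>S i\<close> itself; at equal pressures both sides vanish. For oil the
          mobility is decreasing, which reverses the inequality.\<close>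
        show "?W (S i) * (P\<^sub>w j - P\<^sub>w i) \<le> ?W (upwind_w P\<^sub>w S i j) * (P\<^sub>w j - P\<^sub>w i)"
          using mono by (auto simp: upwind_w_def intro: mult_right_mono)
        show "?Z (upwind_o P\<^sub>o S i j) * (P\<^sub>o j - P\<^sub>o i) \<le> ?Z (S i) * (P\<^sub>o j - P\<^sub>o i)"
          using mono by (auto simp: upwind_o_def intro: mult_right_mono)
        show "P\<^sub>o j - P\<^sub>o i \<le> P\<^sub>w j - P\<^sub>w i"
          using mono pressure[OF i(1)] pressure[OF j] by linarith
      qed (use i in auto)
      \<comment> \<open>As \<open>w i\<close> is positive, the saturation at the node is at least
        its previous value, hence nonnegative.\<close>
      then show False
        using w[OF i(1)] S'[OF i(1)] neg by (simp add: zero_le_mult_iff)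
    qed
    then show ?thesis
      using le[OF k] by linarith
  qed
  have upper: "S k \<le> 1"
  proof -
    obtain i where i: "i \<in> {1..M}" "S i = Max (S ` {1..M})"
      using Max_in[OF fin] by force
    have le: "S j \<le> S i" if "j \<in> {1..M}" for j
      using that by (simp add: i(2))
    have "S i \<le> 1"
    proof (rule ccontr)
      assume gt: "\<not> S i \<le> 1"
      \<comment> \<open>Oil becomes the first phase: the accumulation term changes sign and the
        injected share is replaced by its complement.\<close>
      have "0 \<le> - (w i * (S i - S' i))"
      proof (rule phase_balance_nonneg[OF c m q Z W])
        show "0 < ?Z (S i) + ?W (S i)"
          using WZ[of "S i"] by simp
        \<comment> \<open>A saturation above 1 is clamped to 1, where the water fraction is
          largest.\<close>
        have "?W (si i) / (?W (si i) + ?Z (si i)) \<le> ?W (S i) / (?W (S i) + ?Z (S i))"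
          using gt mobility_w(2) mobility_o(2) by (intro fw_mono) (auto simp: ext01_eq monotone_on_def)
        then show "?Z (S i) / (?Z (S i) + ?W (S i)) \<le> 1 - ?W (si i) / (?W (si i) + ?Z (si i))"
          by (subst fo'[symmetric]) simp
        show "- (w i * (S i - S' i)) - (\<Sum>j=1..M. c i j * (?Z (upwind_o P\<^sub>o S i j) * (P\<^sub>o j - P\<^sub>o i)))
            = m i * ((1 - ?W (si i) / (?W (si i) + ?Z (si i))) * q i - ?Z (S i) / (?Z (S i) + ?W (S i)) * qo i)"
          using oil'[OF i(1)] by (simp add: fo')
        show "- (- (w i * (S i - S' i))) - (\<Sum>j=1..M. c i j * (?W (upwind_w P\<^sub>w S i j) * (P\<^sub>w j - P\<^sub>w i)))
            = m i * ((1 - (1 - ?W (si i) / (?W (si i) + ?Z (si i)))) * q i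
                - (1 - ?Z (S i) / (?Z (S i) + ?W (S i))) * qo i)"
          using water'[OF i(1)] by (simp add: fo'[symmetric])
      next
        fix j assume j: "j \<in> {1..M}"
        note mono = ext01_mono[OF mobility_w(2) le[OF j]] ext01_antimono[OF mobility_o(2) le[OF j]]
          ext01_antimono[OF capillary le[OF j]]
        show "?W (upwind_w P\<^sub>w S i j) * (P\<^sub>w j - P\<^sub>w i) \<le> ?W (S i) * (P\<^sub>w j - P\<^sub>w i)"
          using mono by (auto simp: upwind_w_def intro: mult_right_mono)
        show "?Z (S i) * (P\<^sub>o j - P\<^sub>o i) \<le> ?Z (upwind_o P\<^sub>o S i j) * (P\<^sub>o j - P\<^sub>o i)"
          using mono by (auto simp: upwind_o_def intro: mult_right_mono)
        show "P\<^sub>w j - P\<^sub>w i \<le> P\<^sub>o j - P\<^sub>o i"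
          using mono pressure[OF i(1)] pressure[OF j] by linarith
      qed (use i in auto)
      then show False
        using w[OF i(1)] S'[OF i(1)] gt by (simp add: mult_le_0_iff)
    qed
    then show ?thesis
      using le[OF k] by linarith
  qed
  show ?thesis
    using lower upper by simp
qed

subsection \<open>The boundary of a Lipschitz domain\<close>

text \<open>The domain has no slits: arbitrarily close to a boundary point, above the graph, there
  are open sets that miss the domain and hence its closure, so a boundary point is never interior to
  the closure.\<close>

lemma interior_closure_lipschitz_domain:
  fixes \<Omega> :: "'a::euclidean_space set"
  assumes "lipschitz_domain \<Omega>"
  shows "interior (closure \<Omega>) = \<Omega>"
proof (rule antisym)
  have "open \<Omega>"
    using assms by (simp add: lipschitz_domain_def)
  then show "\<Omega> \<subseteq> interior (closure \<Omega>)"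
    by (simp add: closure_subset interior_maximal)
  show "interior (closure \<Omega>) \<subseteq> \<Omega>"
  proof (rule ccontr)
    assume "\<not> ?thesis"
    then obtain p where p: "p \<in> interior (closure \<Omega>)" "p \<notin> \<Omega>"
      by blast
    then have "p \<in> frontier \<Omega>"
      using \<open>open \<Omega>\<close> interior_subset by (auto simp: frontier_def interior_open)
    then obtain e r L g where e: "norm e = 1" and r: "0 < r" and g: "L-lipschitz_on {y. y \<bullet> e = 0} g"
      and below: "\<And>y. y \<in> ball p r \<Longrightarrow> y \<in> \<Omega> \<longleftrightarrow> y \<bullet> e < g (y - (y \<bullet> e) *\<^sub>R e)"
      using assms unfolding lipschitz_domain_def by meson
    have ee: "e \<bullet> e = 1"
      using e by (simp add: dot_square_norm)
    \<comment> \<open>The height above the graph; near \<open>p\<close> the domain is the set where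
      it is negative. It is continuous everywhere because removing the component along
      \<open>e\<close> lands in the hyperplane on which \<open>g\<close> is Lipschitz.\<close>
    let ?h = "\<lambda>y. y \<bullet> e - g (y - (y \<bullet> e) *\<^sub>R e)"
    have "continuous_on UNIV ?h"
      by (intro continuous_intros continuous_on_compose2[OF lipschitz_on_continuous_on[OF g]])
        (auto simp: inner_diff_left ee)
    then have "open {y. 0 < ?h y}"
      by (intro open_Collect_less) (auto intro: continuous_intros)
    moreover have "open (ball p r \<inter> interior (closure \<Omega>))"
      by auto
    ultimately have "open (ball p r \<inter> interior (closure \<Omega>) \<inter> {y. 0 < ?h y})" (is "open ?U")
      by blast
    moreover have "?U \<inter> \<Omega> = {}"
      using below by force
    ultimately have empty: "?U \<inter> closure \<Omega> = {}"
      by (simp add: open_Int_closure_eq_empty)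
    obtain \<epsilon> where \<epsilon>: "0 < \<epsilon>" "ball p \<epsilon> \<subseteq> ball p r \<inter> interior (closure \<Omega>)"
      using \<open>open (ball p r \<inter> _)\<close> p r by (meson IntI centre_in_ball open_contains_ball_eq)
    \<comment> \<open>Moving along the unit vector \<open>e\<close> keeps the horizontal component,
      so the height grows by exactly half of \<open>\<epsilon>\<close> while the point stays in the
      ball.\<close>
    define z where "z = p + (\<epsilon> / 2) *\<^sub>R e"
    have "z \<in> ball p \<epsilon>"
      using \<epsilon> e by (simp add: z_def dist_norm)
    then have z: "z \<in> ball p r \<inter> interior (closure \<Omega>)"
      using \<epsilon> by blast
    have "0 \<le> ?h p"
      using below[of p] p r by simp
    moreover have "?h z = ?h p + \<epsilon> / 2"
      by (simp add: z_def inner_add_left ee algebra_simps)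
    ultimately have "z \<in> ?U"
      using z \<epsilon> by simp
    then show False
      using z empty interior_subset by blast
  qed
qed

text \<open>By the previous lemma the domain has the same frontier as its closure, a finite union of
  convex sets. The frontier of such a union lies in the union of the frontiers, each of which is a
  null set.\<close>

lemma negligible_frontier_lipschitz_domain:
  fixes \<Omega> :: "'a::euclidean_space set"
  assumes "lipschitz_domain \<Omega>" "finite \<T>" "\<And>K. K \<in> \<T> \<Longrightarrow> convex K" "\<Union>\<T> = closure \<Omega>"
  shows "negligible (frontier \<Omega>)"
proof -
  have "frontier \<Omega> = frontier (\<Union>\<T>)"
    using assms interior_closure_lipschitz_domain[OF assms(1)]
    by (simp add: frontier_def lipschitz_domain_def interior_open)
  also have "\<dots> \<subseteq> (\<Union>K\<in>\<T>. frontier K)"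
    by (rule frontier_Union_subset[OF assms(2)])
  finally have "frontier \<Omega> \<subseteq> (\<Union>K\<in>\<T>. frontier K)" .
  moreover have "negligible (\<Union>K\<in>\<T>. frontier K)"
    using assms(2,3) by (auto intro: negligible_convex_frontier)
  ultimately show ?thesis
    by (rule negligible_subset[rotated])
qed

subsection \<open>Barycentric coordinates on a simplex\<close>

lemma affine_zero_on_convex_hull:
  fixes C :: "'a::euclidean_space set"
  assumes "\<And>v. v \<in> C \<Longrightarrow> a \<bullet> v + k = 0" "y \<in> convex hull C"
  shows "a \<bullet> y + k = 0"
proof -
  have "C \<subseteq> {y. a \<bullet> y = - k}"
    using assms(1) by (auto simp: eq_neg_iff_add_eq_0)
  then have "convex hull C \<subseteq> {y. a \<bullet> y = - k}"
    by (intro hull_minimal convex_hyperplane)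
  then show ?thesis
    using assms(2) by (auto simp: eq_neg_iff_add_eq_0)
qed

text \<open>A point of the simplex is \<open>(1 - u) *\<^sub>R v + u *\<^sub>R z\<close> with
  \<open>z\<close> in the face opposite to \<open>v\<close>, and its coordinate is
  \<open>1 - u\<close>. The condition \<open>u \<le> 1 - s\<close> describes the simplex shrunk
  towards \<open>v\<close> by the factor \<open>1 - s\<close>.\<close>

lemma simplex_superlevel_eq:
  fixes C :: "'a::euclidean_space set"
  assumes C: "v \<in> C" "C \<noteq> {v}"
    and lv: "a \<bullet> v + k = 1" and lC: "\<And>u. u \<in> C - {v} \<Longrightarrow> a \<bullet> u + k = 0"
  shows "y \<in> convex hull C \<Longrightarrow> a \<bullet> y + k \<in> {0..1}"
    and "s \<in> {0..1} \<Longrightarrow> {y \<in> convex hull C. s \<le> a \<bullet> y + k} = (\<lambda>y. (1 - s) *\<^sub>R y + s *\<^sub>R v) ` (convex hull C)"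
proof -
  let ?l = "\<lambda>y. a \<bullet> y + k"
  have "insert v (C - {v}) = C" "C - {v} \<noteq> {}"
    using C by auto
  then have eq: "convex hull C = {(1 - u) *\<^sub>R v + u *\<^sub>R z |z u. 0 \<le> u \<and> u \<le> 1 \<and> z \<in> convex hull (C - {v})}"
    using convex_hull_insert_alt[of v "C - {v}"] by simp
  have l: "?l ((1 - u) *\<^sub>R v + u *\<^sub>R z) = 1 - u" if "z \<in> convex hull (C - {v})" for z u
  proof -
    have z: "a \<bullet> z = - k"
      using affine_zero_on_convex_hull[OF lC that] by simp
    have v: "a \<bullet> v = 1 - k"
      using lv by simp
    show ?thesis
      by (simp add: inner_add_right z v algebra_simps)
  qed
  show range: "y \<in> convex hull C \<Longrightarrow> ?l y \<in> {0..1}" for y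
    using l by (auto simp: eq)
  assume s: "s \<in> {0..1}"
  show "{y \<in> convex hull C. s \<le> ?l y} = (\<lambda>y. (1 - s) *\<^sub>R y + s *\<^sub>R v) ` (convex hull C)"
  proof (intro antisym subsetI)
    fix y assume "y \<in> {y \<in> convex hull C. s \<le> ?l y}"
    then have sl: "s \<le> ?l y" and "y \<in> convex hull C"
      by auto
    then obtain z u where y: "y = (1 - u) *\<^sub>R v + u *\<^sub>R z" and "0 \<le> u"
      and z: "z \<in> convex hull (C - {v})"
      unfolding eq by blast
    then have u: "0 \<le> u" "u \<le> 1 - s"
      using sl l[OF z, of u] by simp_all
    show "y \<in> (\<lambda>y. (1 - s) *\<^sub>R y + s *\<^sub>R v) ` (convex hull C)"
    \<comment> \<open>For \<open>s = 1\<close> only the vertex \<open>v\<close> is left; otherwise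
      dividing \<open>u\<close> by \<open>1 - s\<close> produces the preimage.\<close>
    proof (cases "s = 1")
      case True
      then show ?thesis
        using u y C(1) by (intro image_eqI[of _ _ v]) (auto intro: hull_inc)
    next
      case False
      then have "s < 1"
        using s by simp
      have "(1 - u / (1 - s)) *\<^sub>R v + (u / (1 - s)) *\<^sub>R z \<in> convex hull C"
        unfolding eq mem_Collect_eq using z u \<open>s < 1\<close>
        by (intro exI[of _ z] exI[of _ "u / (1 - s)"]) simp
      moreover have "y = (1 - s) *\<^sub>R ((1 - u / (1 - s)) *\<^sub>R v + (u / (1 - s)) *\<^sub>R z) + s *\<^sub>R v"
      proof -
        have "(1 - s) *\<^sub>R ((1 - u / (1 - s)) *\<^sub>R v + (u / (1 - s)) *\<^sub>R z) + s *\<^sub>R v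
            = ((1 - s) * (1 - u / (1 - s)) + s) *\<^sub>R v + ((1 - s) * (u / (1 - s))) *\<^sub>R z"
          by (simp add: scaleR_add_right scaleR_add_left)
        also have "(1 - s) * (1 - u / (1 - s)) + s = 1 - u"
          using \<open>s < 1\<close> by (simp add: field_simps)
        also have "(1 - s) * (u / (1 - s)) = u"
          using \<open>s < 1\<close> by simp
        finally show ?thesis
          by (simp add: y)
      qed
      ultimately show ?thesis
        by blast
    qed
  next
    fix y assume "y \<in> (\<lambda>y. (1 - s) *\<^sub>R y + s *\<^sub>R v) ` (convex hull C)"
    then obtain z where z: "z \<in> convex hull C" "y = (1 - s) *\<^sub>R z + s *\<^sub>R v"
      by blast
    have "y \<in> convex hull C"
      using convexD[OF convex_convex_hull z(1) hull_inc[OF C(1)], of "1 - s" s] s z(2) by simp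
    moreover have "?l y = (1 - s) * ?l z + s"
    proof -
      have v: "a \<bullet> v = 1 - k"
        using lv by simp
      show ?thesis
        by (simp add: z inner_add_right v algebra_simps)
    qed
    moreover have "0 \<le> (1 - s) * ?l z"
      using range[OF z(1)] s by simp
    ultimately show "y \<in> {y \<in> convex hull C. s \<le> ?l y}"
      by simp
  qed
qed

text \<open>Layer cake: the superlevel sets of a barycentric coordinate are homothetic copies of
  the simplex.\<close>

lemma integral_barycentric_coordinate:
  fixes C :: "'a::euclidean_space set"
  assumes C: "finite C" "v \<in> C" "C \<noteq> {v}"
    and lv: "a \<bullet> v + k = 1" and lC: "\<And>u. u \<in> C - {v} \<Longrightarrow> a \<bullet> u + k = 0"
  shows "(LINT y|lebesgue_on (convex hull C). a \<bullet> y + k) = measure lebesgue (convex hull C) / (real DIM('a) + 1)"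
proof -
  define K where "K = convex hull C"
  define d where "d = DIM('a)"
  define m where "m = measure lebesgue K"
  let ?l = "\<lambda>y. a \<bullet> y + k"
  have K: "compact K"
    using C by (simp add: K_def finite_imp_compact_convex_hull)
  then have [measurable]: "K \<in> sets borel"
    by (simp add: borel_compact)
  have Kl: "K \<in> lmeasurable"
    using K by (rule lmeasurable_compact)
  have l01: "?l y \<in> {0..1}" if "y \<in> K" for y
    using simplex_superlevel_eq(1)[OF C(2,3) lv lC] that by (auto simp: K_def)
  \<comment> \<open>The region under the graph of the coordinate. Integrating its indicator first
    over \<open>s\<close> gives the coordinate, first over \<open>y\<close> the volumes of the
    superlevel sets.\<close>
  let ?A = "{(y, s). y \<in> K \<and> s \<in> {0..1} \<and> s \<le> ?l y}"
  have A_eq: "?A = {z \<in> space (borel \<Otimes>\<^sub>M borel). fst z \<in> K \<and> snd z \<in> {0..1} \<and> snd z \<le> ?l (fst z)}"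
    by (auto simp: space_pair_measure)
  have "?A \<in> sets (borel \<Otimes>\<^sub>M borel)"
    unfolding A_eq by measurable
  then have A_sets [measurable]: "?A \<in> sets (lborel \<Otimes>\<^sub>M lborel)"
    by simp
  have "(\<integral>\<^sup>+ y. ennreal (?l y) * indicator K y \<partial>lborel) = (\<integral>\<^sup>+ y. \<integral>\<^sup>+ s. indicator ?A (y, s) \<partial>lborel \<partial>lborel)"
  proof (rule nn_integral_cong)
    fix y :: 'a
    have "(\<integral>\<^sup>+ s. indicator ?A (y, s) \<partial>lborel) = (\<integral>\<^sup>+ s. indicator K y * indicator {0..?l y} s \<partial>lborel)"
      using l01[of y] by (intro nn_integral_cong) (auto simp: indicator_def)
    also have "\<dots> = ennreal (?l y) * indicator K y"
      using l01[of y] by (auto simp: indicator_def[of K])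
    finally show "ennreal (?l y) * indicator K y = (\<integral>\<^sup>+ s. indicator ?A (y, s) \<partial>lborel)" ..
  qed
  also have "\<dots> = (\<integral>\<^sup>+ s. \<integral>\<^sup>+ y. indicator ?A (y, s) \<partial>lborel \<partial>lborel)"
    by (rule lborel_pair.Fubini'[symmetric]) measurable
  also have "\<dots> = (\<integral>\<^sup>+ s. ennreal ((1 - s) ^ d * m) * indicator {0..1} s \<partial>lborel)"
  proof (rule nn_integral_cong)
    fix s :: real
    show "(\<integral>\<^sup>+ y. indicator ?A (y, s) \<partial>lborel) = ennreal ((1 - s) ^ d * m) * indicator {0..1} s"
    proof (cases "s \<in> {0..1}")
      case True
      then have "(\<integral>\<^sup>+ y. indicator ?A (y, s) \<partial>lborel) = (\<integral>\<^sup>+ y. indicator {y \<in> K. s \<le> ?l y} y \<partial>lborel)"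
        by (intro nn_integral_cong) (auto simp: indicator_def)
      also have "\<dots> = emeasure lborel {y \<in> K. s \<le> ?l y}"
        by (intro nn_integral_indicator) measurable
      also have "\<dots> = emeasure lebesgue {y \<in> K. s \<le> ?l y}"
        by (simp add: emeasure_completion)
      \<comment> \<open>A homothety of ratio \<open>1 - s\<close> with centre \<open>v\<close>
        multiplies the volume by \<open>(1 - s) ^ d\<close>.\<close>
      also have "\<dots> = emeasure lebesgue ((\<lambda>y. (1 - s) *\<^sub>R y + s *\<^sub>R v) ` K)"
        using simplex_superlevel_eq(2)[OF C(2,3) lv lC True] by (simp add: K_def)
      also have "\<dots> = \<bar>1 - s\<bar> ^ d * emeasure lebesgue K"
        unfolding d_def by (rule emeasure_lebesgue_affine)
      also have "\<dots> = ennreal ((1 - s) ^ d * m)"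
        using True Kl by (simp add: m_def emeasure_eq_measure2 ennreal_mult ennreal_power)
      finally show ?thesis
        using True by simp
    qed (auto simp: indicator_def)
  qed
  \<comment> \<open>The antiderivative in \<open>s\<close> is
    \<open>(- m / Suc d) * (1 - s) ^ Suc d\<close>, taken between 0 and 1.\<close>
  also have "\<dots> = ennreal ((- m / Suc d) * (1 - 1) ^ Suc d - (- m / Suc d) * (1 - 0) ^ Suc d)"
  proof (rule nn_integral_FTC_Icc)
    fix s :: real
    have "((\<lambda>s. (1 - s) ^ Suc d) has_field_derivative - (real (Suc d) * (1 - s) ^ d)) (at s)"
      by (auto intro!: derivative_eq_intros simp del: power_Suc of_nat_Suc)
    from DERIV_cmult[OF this, of "- m / Suc d"]
    show "((\<lambda>s. (- m / Suc d) * (1 - s) ^ Suc d) has_field_derivative (1 - s) ^ d * m) (at s)"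
      by (simp add: mult.commute del: power_Suc of_nat_Suc)
  qed (auto simp: m_def)
  also have "\<dots> = ennreal (m / (real d + 1))"
    by (simp add: add.commute)
  finally have nn: "(\<integral>\<^sup>+ y. ennreal (?l y) * indicator K y \<partial>lborel) = ennreal (m / (real d + 1))" .
  have "(LINT y|lebesgue_on K. ?l y) = enn2real (\<integral>\<^sup>+ y. ennreal (?l y) \<partial>lebesgue_on K)"
  proof (rule integral_eq_nn_integral)
    show "?l \<in> borel_measurable (lebesgue_on K)"
      by (intro measurable_restrict_space1 measurable_completion) measurable
    show "AE y in lebesgue_on K. 0 \<le> ?l y"
      using l01 by (intro AE_I2) (auto simp: space_restrict_space)
  qed
  also have "(\<integral>\<^sup>+ y. ennreal (?l y) \<partial>lebesgue_on K) = (\<integral>\<^sup>+ y. ennreal (?l y) * indicator K y \<partial>lborel)"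
    by (subst nn_integral_restrict_space) (auto simp: nn_integral_completion)
  also have "enn2real \<dots> = m / (real d + 1)"
    by (subst nn) (simp add: m_def)
  finally show ?thesis
    by (simp add: K_def d_def m_def)
qed

subsection \<open>Integration over the mesh\<close>

lemma integrable_lebesgue_on_iff:
  fixes f :: "'a::euclidean_space \<Rightarrow> real"
  assumes "S \<in> sets lebesgue"
  shows "integrable (lebesgue_on S) f \<longleftrightarrow> f absolutely_integrable_on S"
  using assms by (simp add: integrable_restrict_space set_integrable_def)

lemma integrable_lebesgue_on_subset:
  fixes f :: "'a::euclidean_space \<Rightarrow> real"
  assumes "integrable (lebesgue_on S) f" "S \<in> sets lebesgue" "T \<in> sets lebesgue" "T \<subseteq> S"
  shows "integrable (lebesgue_on T) f"
  using assms set_integrable_subset by (auto simp: integrable_lebesgue_on_iff)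

lemma integrable_lebesgue_on_compact:
  fixes f :: "'a::euclidean_space \<Rightarrow> real"
  assumes "compact S" "continuous_on S f"
  shows "integrable (lebesgue_on S) f"
proof -
  have "integrable lborel (\<lambda>y. indicator S y *\<^sub>R f y)"
    using borel_integrable_compact[OF assms] by (simp add: indicator_scaleR_eq_if if_distrib cong: if_cong)
  then have "integrable lebesgue (\<lambda>y. indicator S y *\<^sub>R f y)"
    by (simp add: integrable_completion)
  then show ?thesis
    using assms(1) by (simp add: integrable_restrict_space lmeasurable_compact fmeasurableD)
qed

lemma mesh_element:
  fixes K :: "'a::euclidean_space set"
  assumes "conforming_simplicial_mesh \<Omega> \<T>" "K \<in> \<T>"
  shows "compact K" "convex K" "K \<in> sets lebesgue" "finite (vertices K)" "card (vertices K) = DIM('a) + 1"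
    "convex hull (vertices K) = K" "0 < measure lebesgue K" "K \<subseteq> closure \<Omega>"
proof -
  have K: "int DIM('a) simplex K" and sub: "K \<subseteq> closure \<Omega>"
    using assms unfolding conforming_simplicial_mesh_def by auto
  then show "compact K" "convex K" "K \<subseteq> closure \<Omega>"
    using compact_simplex convex_simplex by blast+
  then show "K \<in> sets lebesgue"
    by (simp add: lmeasurable_compact fmeasurableD)
  obtain C where C: "\<not> affine_dependent C" "int (card C) = int DIM('a) + 1" "K = convex hull C"
    using K unfolding simplex_def by auto
  then have "vertices K = C"
    using extreme_point_of_convex_hull_affine_independent by auto
  then show "finite (vertices K)" "card (vertices K) = DIM('a) + 1" "convex hull (vertices K) = K"
    using C aff_independent_finite by auto
  have "aff_dim K = int DIM('a)"
    using aff_dim_simplex K by blast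
  \<comment> \<open>Full dimension gives interior points, and a convex set with interior points is
    not a null set.\<close>
  then have "interior K \<noteq> {}"
    using \<open>convex K\<close> aff_dim_eq_full[of K] rel_interior_interior[of K] rel_interior_eq_empty[of K] by auto
  then have "\<not> negligible K"
    using \<open>convex K\<close> negligible_convex_interior by blast
  moreover have "K \<in> lmeasurable"
    using \<open>compact K\<close> by (rule lmeasurable_compact)
  ultimately show "0 < measure lebesgue K"
    by (simp add: negligible_iff_measure zero_less_measure_iff)
qed

lemma mesh_finite: "conforming_simplicial_mesh \<Omega> \<T> \<Longrightarrow> finite \<T>"
  by (simp add: conforming_simplicial_mesh_def triangulation_def)

lemma mesh_Union: "conforming_simplicial_mesh \<Omega> \<T> \<Longrightarrow> \<Union>\<T> = closure \<Omega>"
  by (simp add: conforming_simplicial_mesh_def)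

text \<open>Two distinct elements meet in a common face. It is a proper face of at least one of
  them, hence of lower dimension, and a convex set of lower dimension is a null set.\<close>

lemma mesh_pairwise_negligible:
  fixes \<T> :: "'a::euclidean_space set set"
  assumes mesh: "conforming_simplicial_mesh \<Omega> \<T>"
  shows "pairwise (\<lambda>K K'. negligible (K \<inter> K')) \<T>"
proof (rule pairwiseI)
  fix K K' assume KK': "K \<in> \<T>" "K' \<in> \<T>" "K \<noteq> K'"
  then have face: "K \<inter> K' face_of K" "K' \<inter> K face_of K'" and dim: "aff_dim K = DIM('a)" "aff_dim K' = DIM('a)"
    using mesh aff_dim_simplex unfolding conforming_simplicial_mesh_def triangulation_def by blast+
  have "aff_dim (K \<inter> K') < DIM('a)"
  proof (cases "K \<inter> K' = K")
    case True
    then have "K' \<inter> K \<noteq> K'"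
      using KK' by auto
    then show ?thesis
      using face_of_aff_dim_lt[OF mesh_element(2)[OF mesh KK'(2)] face(2)] dim by (simp add: Int_commute)
  next
    case False
    then show ?thesis
      using face_of_aff_dim_lt[OF mesh_element(2)[OF mesh KK'(1)] face(1)] dim by simp
  qed
  moreover have "convex (K \<inter> K')"
    using mesh_element(2)[OF mesh] KK' by (simp add: convex_Int)
  ultimately show "negligible (K \<inter> K')"
    by (metis aff_dim_nonempty_interior negligible_convex_interior order_less_irrefl)
qed

text \<open>Additivity holds because the overlaps are null sets. Subfamilies are allowed so that the
  result covers patches as well as the whole domain.\<close>

lemma mesh_integral_Union:
  fixes f :: "'a::euclidean_space \<Rightarrow> real"
  assumes mesh: "conforming_simplicial_mesh \<Omega> \<T>" and "\<S> \<subseteq> \<T>"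
    and f: "integrable (lebesgue_on (closure \<Omega>)) f"
  shows "(LINT y|lebesgue_on (\<Union>\<S>). f y) = (\<Sum>K\<in>\<S>. LINT y|lebesgue_on K. f y)"
\<comment> \<open>Both sides are recognised as the same gauge integral, which is additive over
  pieces with null overlaps.\<close>
proof (rule has_integral_unique)
  have fin: "finite \<S>"
    using assms mesh_finite finite_subset by blast
  have sets: "K \<in> sets lebesgue" if "K \<in> \<S>" for K
    using that assms mesh_element(3) by blast
  then have "\<Union>\<S> \<in> sets lebesgue"
    using fin by (intro sets.finite_Union) auto
  moreover have "\<Union>\<S> \<subseteq> closure \<Omega>"
    using assms mesh_Union by blast
  ultimately have "integrable (lebesgue_on (\<Union>\<S>)) f"
    by (intro integrable_lebesgue_on_subset[OF f]) auto
  then show "(f has_integral (LINT y|lebesgue_on (\<Union>\<S>). f y)) (\<Union>\<S>)"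
    using \<open>\<Union>\<S> \<in> sets lebesgue\<close> by (rule has_integral_integral_lebesgue_on)
  have "integrable (lebesgue_on K) f" if "K \<in> \<S>" for K
    using that assms mesh_element(8)[OF mesh] sets by (intro integrable_lebesgue_on_subset[OF f]) auto
  then show "(f has_integral (\<Sum>K\<in>\<S>. LINT y|lebesgue_on K. f y)) (\<Union>\<S>)"
    using fin sets mesh_pairwise_negligible[OF mesh] \<open>\<S> \<subseteq> \<T>\<close>
    by (intro has_integral_Union has_integral_integral_lebesgue_on) (auto intro: pairwise_subset)
qed

lemma mesh_measure_patch:
  fixes \<T> :: "'a::euclidean_space set set"
  assumes mesh: "conforming_simplicial_mesh \<Omega> \<T>" and "bounded \<Omega>"
  shows "measure lebesgue (patch \<T> p) = (\<Sum>K\<in>{K\<in>\<T>. p \<in> vertices K}. measure lebesgue K)"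
proof -
  have "integrable (lebesgue_on (closure \<Omega>)) (\<lambda>_. 1 :: real)"
    using assms by (intro integrable_lebesgue_on_compact) auto
  from mesh_integral_Union[OF mesh _ this, of "{K\<in>\<T>. p \<in> vertices K}"]
  have "(LINT y|lebesgue_on (patch \<T> p). 1 :: real) = (\<Sum>K\<in>{K\<in>\<T>. p \<in> vertices K}. LINT y|lebesgue_on K. 1)"
    by (simp only: patch_def) auto
  moreover have "patch \<T> p \<in> sets lebesgue"
    using mesh_finite[OF mesh] mesh_element(3)[OF mesh] unfolding patch_def by (intro sets.finite_Union) auto
  moreover have "(\<Sum>K\<in>{K\<in>\<T>. p \<in> vertices K}. LINT y|lebesgue_on K. (1::real))
      = (\<Sum>K\<in>{K\<in>\<T>. p \<in> vertices K}. measure lebesgue K)"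
    using mesh_element(3)[OF mesh] by (intro sum.cong) (auto simp: measure_restrict_space space_restrict_space)
  ultimately show ?thesis
    by (simp add: measure_restrict_space space_restrict_space)
qed

section \<open>The nodal basis on a single element\<close>

lemma nodal_basis_vertices:
  assumes basis: "nodal_basis \<Omega> \<T> M x \<phi>" and "K \<in> \<T>" "v \<in> vertices K"
  obtains i where "i \<in> {1..M}" "x i = v"
proof -
  have "v \<in> x ` {1..M}"
    using assms unfolding nodal_basis_def bij_betw_def mesh_nodes_def by blast
  then show ?thesis
    using that by auto
qed

text \<open>On \<open>K\<close> a hat function is affine with values 0 and 1 at the vertices. It is
  therefore the barycentric coordinate of its own node if that is a vertex of \<open>K\<close>, and
  vanishes on \<open>K\<close> otherwise.\<close>

lemma nodal_basis_integral:
  fixes K :: "'a::euclidean_space set"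
  assumes mesh: "conforming_simplicial_mesh \<Omega> \<T>" and basis: "nodal_basis \<Omega> \<T> M x \<phi>"
    and K: "K \<in> \<T>" and i: "i \<in> {1..M}"
  shows "(LINT y|lebesgue_on K. \<phi> i y) = (if x i \<in> vertices K then measure lebesgue K / (real DIM('a) + 1) else 0)"
proof -
  have "\<phi> i \<in> P1_space \<Omega> \<T>"
    using basis i by (simp add: nodal_basis_def)
  then have "\<exists>a k. \<forall>y\<in>K. \<phi> i y = a \<bullet> y + k"
    using K by (simp add: P1_space_def)
  then obtain a k where \<phi>: "\<And>y. y \<in> K \<Longrightarrow> \<phi> i y = a \<bullet> y + k"
    by blast
  have inj: "inj_on x {1..M}"
    using basis by (simp add: nodal_basis_def bij_betw_def)
  have "vertices K \<subseteq> K"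
    by (auto simp: extreme_point_of_def)
  have node: "a \<bullet> v + k = (if v = x i then 1 else 0)" if v: "v \<in> vertices K" for v
  proof -
    obtain j where j: "j \<in> {1..M}" "x j = v"
      using nodal_basis_vertices[OF basis K v] .
    moreover have "v = x i \<longleftrightarrow> i = j"
      using inj_on_eq_iff[OF inj i j(1)] j(2) by auto
    moreover have "\<phi> i (x j) = (if i = j then 1 else 0)"
      using basis i j unfolding nodal_basis_def by blast
    ultimately show ?thesis
      using \<phi>[of v] v \<open>vertices K \<subseteq> K\<close> by auto
  qed
  note E = mesh_element[OF mesh K]
  have "(LINT y|lebesgue_on K. \<phi> i y) = (LINT y|lebesgue_on K. a \<bullet> y + k)"
    by (intro Bochner_Integration.integral_cong) (auto simp: space_restrict_space \<phi>)
  also have "\<dots> = (if x i \<in> vertices K then measure lebesgue K / (real DIM('a) + 1) else 0)"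
  proof (cases "x i \<in> vertices K")
    case True
    \<comment> \<open>The space has positive dimension, so a simplex has at least two
      vertices.\<close>
    have "vertices K \<noteq> {x i}"
      using E(5) DIM_positive[where 'a='a] by auto
    then show ?thesis
      using integral_barycentric_coordinate[of "vertices K" "x i" a k] E node True by simp
  next
    case False
    have "a \<bullet> y + k = 0" if "y \<in> K" for y
    proof (rule affine_zero_on_convex_hull)
      show "a \<bullet> v + k = 0" if "v \<in> vertices K" for v
        using node[OF that] that False by (metis (no_types))
      show "y \<in> convex hull (vertices K)"
        using that E(6) by simp
    qed
    then have "(LINT y|lebesgue_on K. a \<bullet> y + k) = (LINT y|lebesgue_on K. 0)"
      by (intro Bochner_Integration.integral_cong) (auto simp: space_restrict_space)
    then show ?thesis
      using False by simp
  qed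
  finally show ?thesis .
qed

section \<open>Passage between the domain and its closure\<close>

text \<open>The data are controlled almost everywhere on the open domain, whereas elements and
  patches are closed and may reach its frontier. The difference is a null set.\<close>

lemma AE_lebesgue_on_closure_subset:
  fixes \<Omega> :: "'a::euclidean_space set"
  assumes "AE y in lebesgue_on \<Omega>. P y" "open \<Omega>" "negligible (frontier \<Omega>)" "S \<subseteq> closure \<Omega>" "S \<in> sets lebesgue"
  shows "AE y in lebesgue_on S. P y"
proof -
  have "AE y in lebesgue. y \<notin> frontier \<Omega>"
    using assms(3) by (simp add: negligible_iff_null_sets AE_not_in)
  moreover have "AE y in lebesgue. y \<in> \<Omega> \<longrightarrow> P y"
    using assms(1,2) by (simp add: AE_restrict_space_iff)
  ultimately have "AE y in lebesgue. y \<in> S \<longrightarrow> P y"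
    by eventually_elim (use assms(2,4) in \<open>auto simp: frontier_def interior_open\<close>)
  then show ?thesis
    using assms(5) by (simp add: AE_restrict_space_iff)
qed

lemma integrable_lebesgue_on_closure:
  fixes f :: "'a::euclidean_space \<Rightarrow> real"
  assumes "integrable (lebesgue_on \<Omega>) f" "open \<Omega>" "negligible (frontier \<Omega>)"
  shows "integrable (lebesgue_on (closure \<Omega>)) f"
proof -
  have "f absolutely_integrable_on closure \<Omega>"
  proof (subst absolutely_integrable_spike_set_eq)
    show "f absolutely_integrable_on \<Omega>"
      using assms by (simp add: integrable_lebesgue_on_iff)
    show "negligible {x \<in> closure \<Omega> - \<Omega>. f x \<noteq> 0}"
      using assms(2) by (intro negligible_subset[OF assms(3)]) (auto simp: frontier_def interior_open)
    have "{x \<in> \<Omega> - closure \<Omega>. f x \<noteq> 0} = {}"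
      using closure_subset by auto
    then show "negligible {x \<in> \<Omega> - closure \<Omega>. f x \<noteq> 0}"
      by (metis negligible_empty)
  qed
  then show ?thesis
    by (simp add: integrable_lebesgue_on_iff)
qed

lemma integral_lebesgue_on_closure:
  fixes f :: "'a::euclidean_space \<Rightarrow> real"
  assumes "integrable (lebesgue_on (closure \<Omega>)) f" "open \<Omega>" "negligible (frontier \<Omega>)"
  shows "(LINT y|lebesgue_on \<Omega>. f y) = (LINT y|lebesgue_on (closure \<Omega>). f y)"
proof -
  have "(f has_integral (LINT y|lebesgue_on (closure \<Omega>). f y)) \<Omega>"
    using has_integral_integral_lebesgue_on[OF assms(1)] has_integral_closure[OF assms(3)] by auto
  moreover have "integrable (lebesgue_on \<Omega>) f"
    using assms closure_subset by (intro integrable_lebesgue_on_subset[OF assms(1)]) auto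
  then have "(f has_integral (LINT y|lebesgue_on \<Omega>. f y)) \<Omega>"
    using assms by (intro has_integral_integral_lebesgue_on) auto
  ultimately show ?thesis
    by (rule has_integral_unique[rotated])
qed

section \<open>The averaging interpolation operator\<close>

lemma r_h_node:
  assumes basis: "nodal_basis \<Omega> \<T> M x \<phi>" and i: "i \<in> {1..M}"
  shows "r_h \<T> M x \<phi> f (x i) = (LINT y|lebesgue_on (patch \<T> (x i)). f y) / measure lebesgue (patch \<T> (x i))"
proof -
  have "\<phi> j (x i) = (if j = i then 1 else 0)" if "j \<in> {1..M}" for j
    using basis i that unfolding nodal_basis_def by blast
  then have "r_h \<T> M x \<phi> f (x i) = (\<Sum>j=1..M. if j = i then
      (LINT y|lebesgue_on (patch \<T> (x j)). f y) / measure lebesgue (patch \<T> (x j)) else 0)"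
    unfolding r_h_def fe_fun_def by (intro sum.cong) auto
  then show ?thesis
    using i by simp
qed

lemma measure_patch_pos:
  fixes \<T> :: "'a::euclidean_space set set"
  assumes mesh: "conforming_simplicial_mesh \<Omega> \<T>" and "bounded \<Omega>" and p: "p \<in> mesh_nodes \<T>"
  shows "0 < measure lebesgue (patch \<T> p)"
proof -
  obtain K where K: "K \<in> \<T>" "p \<in> vertices K"
    using p by (auto simp: mesh_nodes_def)
  show ?thesis
    unfolding mesh_measure_patch[OF assms(1,2)]
    using K mesh_finite[OF mesh] mesh_element(7)[OF mesh] by (intro sum_pos) auto
qed

text \<open>The integral of a hat function is the measure of its patch divided by
  \<open>d + 1\<close>, which cancels the normalisation of the patch average. What is left is the
  sum of the patch integrals of \<open>f\<close> over \<open>d + 1\<close>, and every element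
  belongs to the patches of exactly \<open>d + 1\<close> nodes.\<close>

lemma integral_r_h:
  fixes \<Omega> :: "'a::euclidean_space set"
  assumes mesh: "conforming_simplicial_mesh \<Omega> \<T>" and "bounded \<Omega>" "open \<Omega>" "negligible (frontier \<Omega>)"
    and basis: "nodal_basis \<Omega> \<T> M x \<phi>" and f: "integrable (lebesgue_on \<Omega>) f"
  shows "integrable (lebesgue_on \<Omega>) (r_h \<T> M x \<phi> f)"
    and "(LINT y|lebesgue_on \<Omega>. r_h \<T> M x \<phi> f y) = (LINT y|lebesgue_on \<Omega>. f y)"
proof -
  let ?D = "real DIM('a) + 1"
  define A where "A i = (LINT y|lebesgue_on (patch \<T> (x i)). f y)" for i
  define \<mu> where "\<mu> i = measure lebesgue (patch \<T> (x i))" for i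
  have r_h: "r_h \<T> M x \<phi> f = (\<lambda>y. \<Sum>i=1..M. A i / \<mu> i * \<phi> i y)"
    by (simp add: r_h_def fe_fun_def A_def \<mu>_def fun_eq_iff)
  have x: "x i \<in> mesh_nodes \<T>" if "i \<in> {1..M}" for i
    using basis that unfolding nodal_basis_def bij_betw_def by blast
  have \<mu>: "0 < \<mu> i" if "i \<in> {1..M}" for i
    unfolding \<mu>_def using measure_patch_pos[OF mesh] assms(2) x that by blast
  have \<phi>: "integrable (lebesgue_on (closure \<Omega>)) (\<phi> i)" if "i \<in> {1..M}" for i
    using basis that \<open>bounded \<Omega>\<close> unfolding nodal_basis_def P1_space_def
    by (intro integrable_lebesgue_on_compact) auto
  then have int: "integrable (lebesgue_on (closure \<Omega>)) (r_h \<T> M x \<phi> f)"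
    unfolding r_h by (intro Bochner_Integration.integrable_sum integrable_mult_right) auto
  then show "integrable (lebesgue_on \<Omega>) (r_h \<T> M x \<phi> f)"
    using \<open>open \<Omega>\<close> closure_subset by (intro integrable_lebesgue_on_subset[OF int]) auto
  have fc: "integrable (lebesgue_on (closure \<Omega>)) f"
    using assms by (intro integrable_lebesgue_on_closure)
  have sum_filter: "(\<Sum>K\<in>\<T>. if x i \<in> vertices K then g K else 0) = (\<Sum>K\<in>{K\<in>\<T>. x i \<in> vertices K}. g K)"
    for i and g :: "'a set \<Rightarrow> real"
    using mesh_finite[OF mesh] by (simp add: sum.inter_filter)
  have \<phi>_int: "(LINT y|lebesgue_on (closure \<Omega>). \<phi> i y) = \<mu> i / ?D" if i: "i \<in> {1..M}" for i
  proof -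
    have "(LINT y|lebesgue_on (closure \<Omega>). \<phi> i y) = (\<Sum>K\<in>\<T>. LINT y|lebesgue_on K. \<phi> i y)"
      using mesh_integral_Union[OF mesh subset_refl \<phi>[OF i]] by (simp add: mesh_Union[OF mesh])
    also have "\<dots> = (\<Sum>K\<in>\<T>. if x i \<in> vertices K then measure lebesgue K / ?D else 0)"
      by (intro sum.cong refl nodal_basis_integral[OF mesh basis _ i])
    also have "\<dots> = \<mu> i / ?D"
      unfolding sum_filter \<mu>_def mesh_measure_patch[OF mesh \<open>bounded \<Omega>\<close>] by (rule sum_divide_distrib[symmetric])
    finally show ?thesis .
  qed
  have A: "A i = (\<Sum>K\<in>\<T>. if x i \<in> vertices K then LINT y|lebesgue_on K. f y else 0)" for i
    unfolding sum_filter A_def patch_def by (rule mesh_integral_Union[OF mesh _ fc]) auto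
  \<comment> \<open>The numbering of the nodes is injective, so the nodes on an element are counted
    by its vertices.\<close>
  have card: "card {i\<in>{1..M}. x i \<in> vertices K} = DIM('a) + 1" if K: "K \<in> \<T>" for K
  proof -
    have img: "x ` {i\<in>{1..M}. x i \<in> vertices K} = vertices K"
      using nodal_basis_vertices[OF basis K] by auto
    have "inj_on x {i\<in>{1..M}. x i \<in> vertices K}"
      using basis unfolding nodal_basis_def bij_betw_def by (auto intro: inj_on_subset)
    from card_image[OF this] show ?thesis
      by (simp only: img mesh_element(5)[OF mesh K])
  qed
  have "(LINT y|lebesgue_on \<Omega>. r_h \<T> M x \<phi> f y) = (LINT y|lebesgue_on (closure \<Omega>). r_h \<T> M x \<phi> f y)"
    using int assms by (intro integral_lebesgue_on_closure)
  also have "\<dots> = (\<Sum>i=1..M. A i / \<mu> i * (LINT y|lebesgue_on (closure \<Omega>). \<phi> i y))"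
    unfolding r_h using \<phi> by (subst Bochner_Integration.integral_sum) auto
  \<comment> \<open>The patch measure \<open>\<mu> i\<close> cancels because it is positive.\<close>
  also have "\<dots> = (\<Sum>i=1..M. A i / ?D)"
    using \<mu> by (intro sum.cong) (auto simp: \<phi>_int less_imp_neq[symmetric])
  also have "\<dots> = (\<Sum>i=1..M. \<Sum>K\<in>\<T>. if x i \<in> vertices K then (LINT y|lebesgue_on K. f y) / ?D else 0)"
    unfolding A sum_divide_distrib by (intro sum.cong refl) simp
  also have "\<dots> = (\<Sum>K\<in>\<T>. \<Sum>i=1..M. if x i \<in> vertices K then (LINT y|lebesgue_on K. f y) / ?D else 0)"
    by (rule sum.swap)
  also have "\<dots> = (\<Sum>K\<in>\<T>. LINT y|lebesgue_on K. f y)"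
  proof (rule sum.cong[OF refl])
    fix K assume K: "K \<in> \<T>"
    have "(\<Sum>i=1..M. if x i \<in> vertices K then (LINT y|lebesgue_on K. f y) / ?D else 0)
        = (\<Sum>i\<in>{i\<in>{1..M}. x i \<in> vertices K}. (LINT y|lebesgue_on K. f y) / ?D)"
      by (rule sum.inter_filter[symmetric]) simp
    also have "\<dots> = (LINT y|lebesgue_on K. f y)"
      unfolding sum_constant card[OF K] by (simp add: field_simps)
    finally show "(\<Sum>i=1..M. if x i \<in> vertices K then (LINT y|lebesgue_on K. f y) / ?D else 0)
        = (LINT y|lebesgue_on K. f y)" .
  qed
  also have "\<dots> = (LINT y|lebesgue_on (closure \<Omega>). f y)"
    using mesh_integral_Union[OF mesh subset_refl fc] by (simp add: mesh_Union[OF mesh])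
  also have "\<dots> = (LINT y|lebesgue_on \<Omega>. f y)"
    using fc assms by (intro integral_lebesgue_on_closure[symmetric])
  finally show "(LINT y|lebesgue_on \<Omega>. r_h \<T> M x \<phi> f y) = (LINT y|lebesgue_on \<Omega>. f y)" .
qed

section \<open>Slices of space-time functions at a fixed time\<close>

text \<open>Lebesgue measure on the product is a completion, so the exceptional set is first
  enclosed in a Borel null set. Fubini applies to that set, and its measurability allows the
  exchange of the two variables.\<close>

lemma AE_lebesgue_slices:
  fixes P :: "'a::euclidean_space \<times> 'b::euclidean_space \<Rightarrow> bool"
  assumes "AE z in lebesgue. P z"
  shows "AE t in lebesgue. AE y in lebesgue. P (y, t)"
proof -
  have "AE z in lborel. P z"
    using assms by (simp add: AE_completion_iff)
  then obtain Z where Z: "{z. \<not> P z} \<subseteq> Z" "Z \<in> null_sets lborel"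
    by (auto simp: eventually_ae_filter)
  then have ZP: "Z \<in> null_sets (lborel \<Otimes>\<^sub>M lborel)"
    by (simp add: lborel_prod)
  then have [measurable]: "Z \<in> sets (borel \<Otimes>\<^sub>M borel)"
    by (auto simp: null_sets_def)
  have "AE z in lborel \<Otimes>\<^sub>M lborel. z \<notin> Z"
    using ZP by (rule AE_not_in)
  then have "AE y in lborel. AE t in lborel. (y, t) \<notin> Z"
    by (rule lborel_pair.AE_pair)
  then have "AE t in lborel. AE y in lborel. (y, t) \<notin> Z"
    by (subst (asm) lborel_pair.AE_commute) measurable
  then have "AE t in lborel. AE y in lborel. P (y, t)"
    by eventually_elim (rule AE_mp, assumption, use Z in auto)
  then show ?thesis
    by (simp add: AE_completion_iff)
qed

text \<open>The function, extended by zero, agrees almost everywhere with a Borel function. Fubini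
  makes almost every slice of the latter integrable, and for almost every \<open>t\<close> the two
  slices differ only on a null set.\<close>

lemma AE_integrable_slices:
  fixes f :: "'a::euclidean_space \<times> 'b::euclidean_space \<Rightarrow> real"
  assumes f: "integrable (lebesgue_on (A \<times> B)) f" and A: "A \<in> sets lebesgue" and AB: "A \<times> B \<in> sets lebesgue"
  shows "AE t in lebesgue. t \<in> B \<longrightarrow> integrable (lebesgue_on A) (\<lambda>y. f (y, t))"
proof -
  define F where "F z = indicator (A \<times> B) z *\<^sub>R f z" for z
  have F: "integrable lebesgue F"
    using f AB unfolding F_def by (simp add: integrable_restrict_space)
  obtain g where g [measurable]: "g \<in> borel_measurable lborel" and Fg: "AE z in lborel. F z = g z"
    using completion_ex_borel_measurable_real[OF borel_measurable_integrable[OF F]] by blast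
  have "integrable lebesgue g"
    using F Fg g by (subst integrable_cong_AE[of _ _ F]) (auto simp: AE_completion_iff measurable_completion)
  then have "integrable (lborel \<Otimes>\<^sub>M lborel) (\<lambda>(y, t). g (y, t))"
    using g by (simp add: integrable_completion lborel_prod)
  then have int: "AE t in lborel. integrable lborel (\<lambda>y. g (y, t))"
    by (rule lborel_pair.AE_integrable_snd)
  have "AE t in lebesgue. AE y in lebesgue. F (y, t) = g (y, t)"
    using Fg by (intro AE_lebesgue_slices) (simp add: AE_completion_iff)
  moreover have "AE t in lebesgue. integrable lebesgue (\<lambda>y. g (y, t))"
    using AE_completion[OF int] by eventually_elim (simp add: integrable_completion borel_measurable_integrable)
  ultimately show ?thesis
  proof eventually_elim
    fix t assume eq: "AE y in lebesgue. F (y, t) = g (y, t)" and "integrable lebesgue (\<lambda>y. g (y, t))"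
    then have g_int: "(\<lambda>y. g (y, t)) absolutely_integrable_on UNIV"
      by (simp add: set_integrable_def)
    show "t \<in> B \<longrightarrow> integrable (lebesgue_on A) (\<lambda>y. f (y, t))"
    proof
      assume t: "t \<in> B"
      obtain Z where Z: "{y. F (y, t) \<noteq> g (y, t)} \<subseteq> Z" "negligible Z"
        using eq by (auto simp: eventually_ae_filter negligible_iff_null_sets)
      have "(\<lambda>y. F (y, t)) absolutely_integrable_on UNIV"
        using Z(1) by (intro absolutely_integrable_spike[OF g_int Z(2)]) auto
      moreover have "(\<lambda>y. F (y, t)) = (\<lambda>y. indicator A y *\<^sub>R f (y, t))"
        using t by (auto simp: F_def fun_eq_iff indicator_def)
      ultimately show "integrable (lebesgue_on A) (\<lambda>y. f (y, t))"
        using A by (simp add: integrable_restrict_space set_integrable_def)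
    qed
  qed
qed

subsection \<open>Bounds on the discrete data\<close>

lemma AE_lebesgue_on_const:
  assumes "AE y in lebesgue_on K. P" "0 < measure lebesgue K" "K \<in> sets lebesgue"
  shows P
proof (rule ccontr)
  assume "\<not> P"
  then have "AE y in lebesgue_on K. False"
    using assms(1) by simp
  then have "ae_filter (lebesgue_on K) = bot"
    by (simp add: trivial_limit_def)
  then have "emeasure lebesgue K = 0"
    using assms(3) by (simp add: ae_filter_eq_bot_iff emeasure_restrict_space space_restrict_space)
  then show False
    using assms(2) by (simp add: measure_def)
qed

text \<open>Two almost everywhere values coincide on a set of positive measure, so the definite
  description denotes \<open>c\<close>; the bound on \<open>f\<close> passes to \<open>c\<close> for
  the same reason.\<close>

lemma element_value_ge:
  fixes K :: "'a::euclidean_space set"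
  assumes c: "AE y in lebesgue_on K. f y = c" and ge: "AE y in lebesgue_on K. b \<le> f y"
    and K: "0 < measure lebesgue K" "K \<in> sets lebesgue"
  shows "b \<le> element_value f K"
proof -
  have "c' = c" if "AE y in lebesgue_on K. f y = c'" for c'
  proof -
    have "AE y in lebesgue_on K. c' = c"
      using c that by eventually_elim simp
    then show ?thesis
      using K by (rule AE_lebesgue_on_const)
  qed
  then have "element_value f K = c"
    unfolding element_value_def using c by (intro the_equality)
  moreover have "AE y in lebesgue_on K. b \<le> c"
    using c ge by eventually_elim simp
  then have "b \<le> c"
    using K by (rule AE_lebesgue_on_const)
  ultimately show ?thesis
    by simp
qed

lemma integral_average_in_01:
  fixes f :: "'a::euclidean_space \<Rightarrow> real"
  assumes "A \<in> lmeasurable" "AE y in lebesgue_on A. 0 \<le> f y \<and> f y \<le> 1"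
  shows "(LINT y|lebesgue_on A. f y) / measure lebesgue A \<in> {0..1}"
proof -
  have "AE y in lebesgue_on A. 0 \<le> f y" "AE y in lebesgue_on A. f y \<le> 1"
    using assms(2) by auto
  moreover have "integrable (lebesgue_on A) (\<lambda>_. 1 :: real)"
    using finite_measure.integrable_const[OF finite_measure_lebesgue_on[OF assms(1)]] .
  \<comment> \<open>A function that is not integrable has integral 0 by convention, which respects
    both bounds.\<close>
  ultimately have "0 \<le> (LINT y|lebesgue_on A. f y)" "(LINT y|lebesgue_on A. f y) \<le> (LINT y|lebesgue_on A. 1)"
    using integral_mono_AE'[of "lebesgue_on A" "\<lambda>_. 1" f] by (auto intro: integral_nonneg_AE)
  moreover have "(LINT y|lebesgue_on A. 1) = measure lebesgue A"
    using assms(1) by (simp add: measure_restrict_space space_restrict_space fmeasurableD)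
  ultimately show ?thesis
    by (auto simp: divide_le_eq_1 zero_le_divide_iff measure_nonneg less_le)
qed

lemma patch_lmeasurable:
  assumes mesh: "conforming_simplicial_mesh \<Omega> \<T>"
  shows "patch \<T> p \<in> lmeasurable"
  using mesh_finite[OF mesh] mesh_element(1)[OF mesh] unfolding patch_def
  by (intro lmeasurable_compact compact_Union) auto

lemma patch_subset:
  assumes mesh: "conforming_simplicial_mesh \<Omega> \<T>"
  shows "patch \<T> p \<subseteq> closure \<Omega>"
  using mesh_Union[OF mesh] by (auto simp: patch_def)

text \<open>On an element the function is affine, so the points where its value lies in the unit
  interval form a convex set. This set contains the vertices and hence the element.\<close>

lemma fe_fun_in_01:
  fixes \<T> :: "'a::euclidean_space set set"
  assumes mesh: "conforming_simplicial_mesh \<Omega> \<T>" and basis: "nodal_basis \<Omega> \<T> M x \<phi>"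
    and c: "\<And>i. i \<in> {1..M} \<Longrightarrow> c i \<in> {0..1}" and y: "y \<in> closure \<Omega>"
  shows "fe_fun M \<phi> c y \<in> {0..1}"
proof -
  obtain K where K: "K \<in> \<T>" "y \<in> K"
    using y mesh_Union[OF mesh] by blast
  have "\<forall>i\<in>{1..M}. \<exists>a k. \<forall>y\<in>K. \<phi> i y = a \<bullet> y + k"
    using basis K unfolding nodal_basis_def P1_space_def by blast
  then obtain a k where \<phi>: "\<And>i y. i \<in> {1..M} \<Longrightarrow> y \<in> K \<Longrightarrow> \<phi> i y = a i \<bullet> y + k i"
    by metis
  define b where "b = (\<Sum>i=1..M. c i *\<^sub>R a i)"
  define l where "l = (\<Sum>i=1..M. c i * k i)"
  have fe: "fe_fun M \<phi> c y = b \<bullet> y + l" if "y \<in> K" for y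
    unfolding fe_fun_def b_def l_def using \<phi>[OF _ that]
    by (simp add: inner_sum_left algebra_simps flip: sum.distrib)
  have node: "b \<bullet> v + l \<in> {0..1}" if v: "v \<in> vertices K" for v
  proof -
    obtain j where j: "j \<in> {1..M}" "x j = v"
      using nodal_basis_vertices[OF basis K(1) v] .
    have "\<phi> i v = (if i = j then 1 else 0)" if "i \<in> {1..M}" for i
      using basis that j unfolding nodal_basis_def by blast
    then have "fe_fun M \<phi> c v = (\<Sum>i=1..M. if i = j then c i else 0)"
      unfolding fe_fun_def by (intro sum.cong) auto
    then have "fe_fun M \<phi> c v = c j"
      using j by simp
    moreover have "v \<in> K"
      using v by (simp add: extreme_point_of_def)
    ultimately show ?thesis
      using fe[of v] c[OF j(1)] by simp
  qed
  have "{y. b \<bullet> y + l \<in> {0..1}} = {y. b \<bullet> y \<ge> - l} \<inter> {y. b \<bullet> y \<le> 1 - l}"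
    by auto
  then have "convex {y. b \<bullet> y + l \<in> {0..1}}"
    by (simp add: convex_Int convex_halfspace_le convex_halfspace_ge)
  then have "convex hull (vertices K) \<subseteq> {y. b \<bullet> y + l \<in> {0..1}}"
    using node by (intro hull_minimal) auto
  then show ?thesis
    using K fe mesh_element(6)[OF mesh K(1)] by auto
qed

text \<open>The time intervals are closed on the right, so the end point of an interval represents
  its step.\<close>

lemma step_index_node: "0 < \<tau> \<Longrightarrow> step_index \<tau> (real n * \<tau>) = n"
  by (simp add: step_index_def)

text \<open>The rate is an average over time, so it is enough to know the sign for almost every
  time. At such a time the slice is integrable, which lets \<open>integral_r_h\<close> remove the
  correcting constant.\<close>

lemma flow_rate_nonneg:
  fixes \<Omega> :: "'a::euclidean_space set"
  assumes mesh: "conforming_simplicial_mesh \<Omega> \<T>" and \<Omega>: "bounded \<Omega>" "open \<Omega>" "negligible (frontier \<Omega>)"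
    and basis: "nodal_basis \<Omega> \<T> M x \<phi>" and i: "i \<in> {1..M}"
    and q: "in_L2 (\<Omega> \<times> {0<..<T}) q" "AE z in lebesgue_on (\<Omega> \<times> {0<..<T}). 0 \<le> q z"
    and n: "1 \<le> n" "n \<le> N" and \<tau>: "0 < \<tau>" "real N * \<tau> = T"
  shows "0 \<le> flow_rate_h\<tau> \<Omega> \<T> M x \<phi> \<tau> q (real n * \<tau>) (x i)"
proof -
  have prod_lm: "\<Omega> \<times> {0<..<T} \<in> lmeasurable"
    using \<Omega> by (intro lmeasurable_open bounded_Times open_Times) auto
  then have prod: "\<Omega> \<times> {0<..<T} \<in> sets lebesgue"
    by (rule fmeasurableD)
  have "q \<in> borel_measurable (lebesgue_on (\<Omega> \<times> {0<..<T}))"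
    and "integrable (lebesgue_on (\<Omega> \<times> {0<..<T})) (\<lambda>z. (q z)\<^sup>2)"
    using q(1) unfolding in_L2_def by blast+
  \<comment> \<open>On a set of finite measure square integrability implies integrability, as Fubini
    requires.\<close>
  then have "integrable (lebesgue_on (\<Omega> \<times> {0<..<T})) q"
    by (rule finite_measure.square_integrable_imp_integrable[OF finite_measure_lebesgue_on[OF prod_lm]])
  then have int: "AE t in lebesgue. t \<in> {0<..<T} \<longrightarrow> integrable (lebesgue_on \<Omega>) (\<lambda>y. q (y, t))"
    using \<Omega>(2) by (intro AE_integrable_slices[OF _ _ prod]) auto
  have "AE z in lebesgue. z \<in> \<Omega> \<times> {0<..<T} \<longrightarrow> 0 \<le> q z"
    using q(2) prod by (simp add: AE_restrict_space_iff)
  then have nonneg: "AE t in lebesgue. AE y in lebesgue. (y, t) \<in> \<Omega> \<times> {0<..<T} \<longrightarrow> 0 \<le> q (y, t)"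
    by (rule AE_lebesgue_slices)
  let ?I = "{(real n - 1) * \<tau>..real n * \<tau>}"
  have "real n * \<tau> \<le> real N * \<tau>"
    using n \<tau> by (intro mult_right_mono) auto
  then have I: "?I \<subseteq> {0..T}"
    using n \<tau> by auto
  \<comment> \<open>The closed step interval may contain the times 0 and \<open>T\<close>, at which
    nothing is known about \<open>q\<close>; they form a null set.\<close>
  have ends: "AE t in lebesgue. t \<noteq> 0" "AE t in lebesgue. t \<noteq> T"
    by (auto intro!: AE_completion AE_lborel_singleton)
  have "AE t in lebesgue. t \<in> ?I \<longrightarrow> 0 \<le> r_h \<T> M x \<phi> (\<lambda>z. q (z, t)) (x i)
      - (LINT z|lebesgue_on \<Omega>. r_h \<T> M x \<phi> (\<lambda>z. q (z, t)) z - q (z, t)) / measure lebesgue \<Omega>"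
    using int nonneg ends
  proof eventually_elim
    fix t
    assume int: "t \<in> {0<..<T} \<longrightarrow> integrable (lebesgue_on \<Omega>) (\<lambda>y. q (y, t))"
      and nonneg: "AE y in lebesgue. (y, t) \<in> \<Omega> \<times> {0<..<T} \<longrightarrow> 0 \<le> q (y, t)" and "t \<noteq> 0" "t \<noteq> T"
    let ?q = "\<lambda>y. q (y, t)"
    show "t \<in> ?I \<longrightarrow> 0 \<le> r_h \<T> M x \<phi> ?q (x i) - (LINT z|lebesgue_on \<Omega>. r_h \<T> M x \<phi> ?q z - q (z, t)) / measure lebesgue \<Omega>"
    proof
      assume "t \<in> ?I"
      then have t: "t \<in> {0<..<T}"
        using I \<open>t \<noteq> 0\<close> \<open>t \<noteq> T\<close> by fastforce
      then have qt: "integrable (lebesgue_on \<Omega>) ?q"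
        using int by blast
      have "(LINT z|lebesgue_on \<Omega>. r_h \<T> M x \<phi> ?q z - q (z, t)) = 0"
        using integral_r_h[OF mesh \<Omega> basis qt] qt by simp
      moreover have "AE y in lebesgue_on \<Omega>. 0 \<le> ?q y"
        using nonneg t \<Omega>(2) by (simp add: AE_restrict_space_iff)
      then have "AE y in lebesgue_on (patch \<T> (x i)). 0 \<le> ?q y"
        by (rule AE_lebesgue_on_closure_subset[OF _ \<Omega>(2,3) patch_subset[OF mesh] fmeasurableD[OF patch_lmeasurable[OF mesh]]])
      then have "0 \<le> r_h \<T> M x \<phi> ?q (x i)"
        unfolding r_h_node[OF basis i] by (intro divide_nonneg_nonneg integral_nonneg_AE) auto
      ultimately show "0 \<le> r_h \<T> M x \<phi> ?q (x i)
          - (LINT z|lebesgue_on \<Omega>. r_h \<T> M x \<phi> ?q z - q (z, t)) / measure lebesgue \<Omega>"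
        by simp
    qed
  qed
  then have "AE t in lebesgue_on ?I. 0 \<le> r_h \<T> M x \<phi> (\<lambda>z. q (z, t)) (x i)
      - (LINT z|lebesgue_on \<Omega>. r_h \<T> M x \<phi> (\<lambda>z. q (z, t)) z - q (z, t)) / measure lebesgue \<Omega>"
    by (simp add: AE_restrict_space_iff)
  then show ?thesis
    unfolding flow_rate_h\<tau>_def \<rho>_def step_index_node[OF \<tau>(1)]
    using \<tau>(1) by (intro divide_nonneg_nonneg integral_nonneg_AE) auto
qed

subsection \<open>The maximum principle\<close>

theorem theorem3p1:
  fixes \<Omega> :: "(real ^ 'n) set"
    and T \<tau> h \<eta>\<^sub>s\<^sub>t\<^sub>a\<^sub>r por\<^sub>m\<^sub>i\<^sub>n por\<^sub>m\<^sub>a\<^sub>x :: real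
    and N M :: nat
    and por s\<^sub>0 :: "real ^ 'n \<Rightarrow> real"
    and \<eta>\<^sub>w \<eta>\<^sub>o p\<^sub>c :: "real \<Rightarrow> real"
    and qin qout s\<^sub>i\<^sub>n :: "(real ^ 'n) \<times> real \<Rightarrow> real"
    and H :: "real set"
    and Th :: "real \<Rightarrow> (real ^ 'n) set set"
    and x :: "nat \<Rightarrow> real ^ 'n"
    and \<phi> :: "nat \<Rightarrow> real ^ 'n \<Rightarrow> real"
    and S P\<^sub>w P\<^sub>o :: "nat \<Rightarrow> nat \<Rightarrow> real"
  assumes dim: "CARD('n) \<in> {2, 3}"
    and domain: "\<Omega> \<noteq> {}" "bounded \<Omega>" "connected \<Omega>" "lipschitz_domain \<Omega>" "polytopal \<Omega>"
    and time: "0 < T" "0 < N" "\<tau> = T / real N"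
    and porosity: "0 < por\<^sub>m\<^sub>i\<^sub>n" "AE y in lebesgue_on \<Omega>. por\<^sub>m\<^sub>i\<^sub>n \<le> por y \<and> por y \<le> por\<^sub>m\<^sub>a\<^sub>x"
    and mobility_w: "continuous_on {0..1} \<eta>\<^sub>w" "\<forall>s\<in>{0..1}. 0 \<le> \<eta>\<^sub>w s" "mono_on {0..1} \<eta>\<^sub>w"
    and mobility_o: "continuous_on {0..1} \<eta>\<^sub>o" "\<forall>s\<in>{0..1}. 0 \<le> \<eta>\<^sub>o s" "antimono_on {0..1} \<eta>\<^sub>o"
    and mobility_sum: "0 < \<eta>\<^sub>s\<^sub>t\<^sub>a\<^sub>r" "\<forall>s\<in>{0..1}. \<eta>\<^sub>s\<^sub>t\<^sub>a\<^sub>r \<le> \<eta>\<^sub>w s + \<eta>\<^sub>o s"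
    and capillary: "in_W11 0 1 p\<^sub>c" "continuous_on {0..1} p\<^sub>c" "strict_antimono_on {0..1} p\<^sub>c"
    and flow_rates: "in_L2 (\<Omega> \<times> {0<..<T}) qin" "in_L2 (\<Omega> \<times> {0<..<T}) qout"
      "AE z in lebesgue_on (\<Omega> \<times> {0<..<T}). 0 \<le> qin z"
      "AE z in lebesgue_on (\<Omega> \<times> {0<..<T}). 0 \<le> qout z"
      "AE t in lebesgue_on {0<..<T}.
         (LINT y|lebesgue_on \<Omega>. qin (y, t)) = (LINT y|lebesgue_on \<Omega>. qout (y, t))"
    and inflow_saturation: "s\<^sub>i\<^sub>n \<in> borel_measurable (lebesgue_on (\<Omega> \<times> {0<..<T}))"
      "AE z in lebesgue_on (\<Omega> \<times> {0<..<T}). 0 \<le> s\<^sub>i\<^sub>n z \<and> s\<^sub>i\<^sub>n z \<le> 1"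
    and initial_saturation: "s\<^sub>0 \<in> borel_measurable (lebesgue_on \<Omega>)"
      "AE y in lebesgue_on \<Omega>. 0 \<le> s\<^sub>0 y \<and> s\<^sub>0 y \<le> 1"
    and mesh: "regular_mesh_family \<Omega> H Th" "\<forall>k\<in>H. \<forall>K\<in>Th k. nonobtuse K" "h \<in> H"
    and porosity_const: "\<forall>K\<in>Th h. \<exists>c. AE y in lebesgue_on K. por y = c"
    and basis: "nodal_basis \<Omega> (Th h) M x \<phi>"
    and solution: "discrete_solution \<Omega> por \<eta>\<^sub>w \<eta>\<^sub>o p\<^sub>c qin qout s\<^sub>i\<^sub>n s\<^sub>0 (Th h) M x \<phi> \<tau> N S P\<^sub>w P\<^sub>o"
  shows "\<forall>t\<in>{0..T}. \<forall>y\<in>closure \<Omega>. 0 \<le> S_h\<tau> M \<phi> \<tau> S t y \<and> S_h\<tau> M \<phi> \<tau> S t y \<le> 1"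
proof -
  have conf: "conforming_simplicial_mesh \<Omega> (Th h)"
    using mesh unfolding regular_mesh_family_def by blast
  have \<Omega>: "bounded \<Omega>" "open \<Omega>"
    using domain by (auto simp: lipschitz_domain_def)
  have frontier: "negligible (frontier \<Omega>)"
    using negligible_frontier_lipschitz_domain[OF domain(4) mesh_finite[OF conf] mesh_element(2)[OF conf] mesh_Union[OF conf]] .
  have \<tau>: "0 < \<tau>" "real N * \<tau> = T"
    using time by auto
  \<comment> \<open>Positivity of these coefficients turns a sign of the accumulation term into a
    comparison with the previous step. The patch of a node contains at least one element, and the
    lower bound for the porosity passes to its element value.\<close>
  have mass: "0 < weighted_mass por (Th h) (x i)" if i: "i \<in> {1..M}" for i
  proof -
    have "x i \<in> mesh_nodes (Th h)"
      using basis i unfolding nodal_basis_def bij_betw_def by blast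
    then obtain K where K: "K \<in> Th h" "x i \<in> vertices K"
      by (auto simp: mesh_nodes_def)
    have pos: "0 < element_value por K * measure lebesgue K" if K: "K \<in> Th h" for K
    proof -
      obtain c where "AE y in lebesgue_on K. por y = c"
        using porosity_const K by blast
      moreover have "AE y in lebesgue_on K. por\<^sub>m\<^sub>i\<^sub>n \<le> por y \<and> por y \<le> por\<^sub>m\<^sub>a\<^sub>x"
        using mesh_element[OF conf K] by (intro AE_lebesgue_on_closure_subset[OF porosity(2) \<Omega>(2) frontier])
      then have "AE y in lebesgue_on K. por\<^sub>m\<^sub>i\<^sub>n \<le> por y"
        by auto
      ultimately have "por\<^sub>m\<^sub>i\<^sub>n \<le> element_value por K"
        using mesh_element[OF conf K] by (intro element_value_ge)
      then show ?thesis
        using porosity(1) mesh_element(7)[OF conf K] by simp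
    qed
    show ?thesis
      unfolding weighted_mass_def using mesh_finite[OF conf] pos K
      by (intro divide_pos_pos sum_pos) auto
  qed
  \<comment> \<open>Induction over the time steps; the initial nodal values are averages of
    \<open>s\<^sub>0\<close> over patches.\<close>
  have bounds: "S n i \<in> {0..1}" if "n \<le> N" "i \<in> {1..M}" for n i
    using that
  proof (induction n arbitrary: i)
    case 0
    have "AE y in lebesgue_on (patch (Th h) (x i)). 0 \<le> s\<^sub>0 y \<and> s\<^sub>0 y \<le> 1"
      by (rule AE_lebesgue_on_closure_subset[OF initial_saturation(2) \<Omega>(2) frontier patch_subset[OF conf]
            fmeasurableD[OF patch_lmeasurable[OF conf]]])
    then have "r_h (Th h) M x \<phi> s\<^sub>0 (x i) \<in> {0..1}"
      unfolding r_h_node[OF basis 0(2)] by (intro integral_average_in_01 patch_lmeasurable[OF conf])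
    moreover have "S 0 i = r_h (Th h) M x \<phi> s\<^sub>0 (x i)"
      using solution 0(2) unfolding discrete_solution_def by blast
    ultimately show ?case
      by simp
  next
    case (Suc n)
    then have n: "Suc n \<in> {1..N}"
      by simp
    have step: "\<And>i. i \<in> {1..M} \<Longrightarrow> weighted_mass por (Th h) (x i) / \<tau> * (S (Suc n) i - S n i)
          - (\<Sum>j=1..M. edge_coeff (Th h) x \<phi> i j * ext01 \<eta>\<^sub>w (upwind_w (P\<^sub>w (Suc n)) (S (Suc n)) i j)
              * (P\<^sub>w (Suc n) j - P\<^sub>w (Suc n) i))
        = lumped_mass (Th h) (x i) *
          (ext01 (frac_w \<eta>\<^sub>w \<eta>\<^sub>o) (saturation_h\<tau> (Th h) M x \<phi> \<tau> s\<^sub>i\<^sub>n (real (Suc n) * \<tau>) (x i))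
              * flow_rate_h\<tau> \<Omega> (Th h) M x \<phi> \<tau> qin (real (Suc n) * \<tau>) (x i)
            - ext01 (frac_w \<eta>\<^sub>w \<eta>\<^sub>o) (S (Suc n) i) * flow_rate_h\<tau> \<Omega> (Th h) M x \<phi> \<tau> qout (real (Suc n) * \<tau>) (x i))"
      "\<And>i. i \<in> {1..M} \<Longrightarrow> - (weighted_mass por (Th h) (x i) / \<tau> * (S (Suc n) i - S n i))
          - (\<Sum>j=1..M. edge_coeff (Th h) x \<phi> i j * ext01 \<eta>\<^sub>o (upwind_o (P\<^sub>o (Suc n)) (S (Suc n)) i j)
              * (P\<^sub>o (Suc n) j - P\<^sub>o (Suc n) i))
        = lumped_mass (Th h) (x i) *
          (ext01 (frac_o \<eta>\<^sub>w \<eta>\<^sub>o) (saturation_h\<tau> (Th h) M x \<phi> \<tau> s\<^sub>i\<^sub>n (real (Suc n) * \<tau>) (x i))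
              * flow_rate_h\<tau> \<Omega> (Th h) M x \<phi> \<tau> qin (real (Suc n) * \<tau>) (x i)
            - ext01 (frac_o \<eta>\<^sub>w \<eta>\<^sub>o) (S (Suc n) i) * flow_rate_h\<tau> \<Omega> (Th h) M x \<phi> \<tau> qout (real (Suc n) * \<tau>) (x i))"
      "\<And>i. i \<in> {1..M} \<Longrightarrow> P\<^sub>o (Suc n) i - P\<^sub>w (Suc n) i = ext01 p\<^sub>c (S (Suc n) i)"
      using solution[unfolded discrete_solution_def, THEN conjunct2, THEN bspec, OF n, THEN conjunct1]
      by (simp_all only: Let_def diff_Suc_1)
    show ?case
    proof (rule saturation_step_bounds[OF mobility_w(2,3) mobility_o(2,3) _ _ _ _ _ _ step])
      show "\<forall>s\<in>{0..1}. 0 < \<eta>\<^sub>w s + \<eta>\<^sub>o s"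
        using mobility_sum by fastforce
      show "antimono_on {0..1} p\<^sub>c"
        using capillary(3) by (auto simp: monotone_on_def le_less)
      show "0 < weighted_mass por (Th h) (x i) / \<tau>" if "i \<in> {1..M}" for i
        using mass[OF that] \<tau> by simp
      show "0 \<le> flow_rate_h\<tau> \<Omega> (Th h) M x \<phi> \<tau> qin (real (Suc n) * \<tau>) (x i)" if "i \<in> {1..M}" for i
        using n by (intro flow_rate_nonneg[OF conf \<Omega> frontier basis that flow_rates(1,3) _ _ \<tau>]) auto
      show "S n i \<in> {0..1}" if "i \<in> {1..M}" for i
        using Suc that by simp
    \<comment> \<open>The edge coefficients are integrals of absolute values, hence
      nonnegative.\<close>
    qed (use Suc in \<open>auto simp: lumped_mass_def edge_coeff_def intro: integral_nonneg_AE\<close>)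
  qed
  show ?thesis
  proof (intro ballI)
    fix t y assume t: "t \<in> {0..T}" and y: "y \<in> closure \<Omega>"
    \<comment> \<open>The step index is a ceiling, so a time up to \<open>T\<close> gives at most
      \<open>N\<close>; time 0 gives index 0, the initial saturation.\<close>
    have "t / \<tau> \<le> real N"
      using t \<tau> by (simp add: pos_divide_le_eq)
    then have "step_index \<tau> t \<le> N"
      unfolding step_index_def by linarith
    then have "S_h\<tau> M \<phi> \<tau> S t y \<in> {0..1}"
      unfolding S_h\<tau>_def using bounds by (intro fe_fun_in_01[OF conf basis _ y])
    then show "0 \<le> S_h\<tau> M \<phi> \<tau> S t y \<and> S_h\<tau> M \<phi> \<tau> S t y \<le> 1"
      by simp
  qed
qed

end
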